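(* Let $t>0$, let $\phi:[0,\infty)\to\mathbb{R}$, $s\mapsto\phi_s$, be a fee-rate function (locally integrable), and let $(x^\star,a^\star)$ be the investor's chosen optimal solution of the allocation problem (as defined in the context, including the tie-breaking rule). Let $$\Phi(t)=P_0\left[e^{(g-m-\rho)t}\left(e^{rt}+1\right)-2e^{\left(\frac12 g-\frac18\sigma^2-\frac12 m-\rho\right)t}\right].$$ Then $x^\star=\frac{1}{2P_0}$ and $a^\star=\frac12$ if and only if $$\int_0^t\phi_s e^{-\rho s}\,ds>\Phi(t).$$
   Context: Model. $B$ is a standard Brownian motion. The price $P_t$ of a liquid staking token (LST) in ETH satisfies $dP_t/P_t=g\,dt+\sigma\,dB_t$ with deterministic initial price $P_0$, $g\ge 0$, $\sigma>0$. $D_t=e^{-mt}$ with $m>0$ is an exit discount factor, $r\ge 0$ is the staking reward rate, $\rho\ge 0$ is the investor's discount rate. The token is either rebasing ($P_0=1$, $g=0$, $r>0$) or reward-bearing ($P_0>1$, $g>0$, $r=0$). Standing assumption: $r+g-\rho-m>\ln P_0>0$. Allocation problem (for fixed $t>0$): over $(x,a)\in\mathbb{R}^2$, maximize $$\left\{-e^{-\rho t}\,\mathbb{E}\left[\left(\sqrt{D_tP_t}-\sqrt{P_0}\right)^2\right]+\int_0^t\phi_se^{-\rho s}ds\right\}x-e^{-\rho t}\left[\frac{\mathbb{E}(D_tP_t)e^{rt}}{P_0}-1\right]a+e^{-\rho t}\frac{\mathbb{E}(D_tP_t)e^{rt}}{P_0}$$ subject to $P_0x\le a\le 1-P_0x$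 and $0\le x\le\frac{1}{2P_0}$. (Here $a$ is the ETH not staked, $x$ the LST deposited in the AMM, and $y=P_0x$ the ETH deposited in the AMM.) Tie-breaking rule: $(x^\star,a^\star)$ is an optimal solution; if every $x\in[0,\frac{1}{2P_0}]$ is optimal (i.e. is the $x$-component of an optimal solution), then the investor chooses the optimal solution with $x^\star=0$; similarly, if every $a\in[0,1]$ is optimal, the investor chooses $a^\star=0$. *)

theory Defs
  imports "HOL-Probability.Probability"
begin

text \<open>Processes are functions of type \<open>real \<Rightarrow> 'a \<Rightarrow> real\<close>; only their values at times
  \<open>s \<ge> 0\<close> are constrained.  The filtration may be any one for which \<open>B\<close> is a
  Brownian motion, for instance the natural filtration of \<open>B\<close>.\<close>

definition adapted_process :: "(real \<Rightarrow> 'a measure) \<Rightarrow> (real \<Rightarrow> 'a \<Rightarrow> real) \<Rightarrow> bool" where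
  "adapted_process F X \<longleftrightarrow> (\<forall>s\<ge>0. X s \<in> borel_measurable (F s))"

definition continuous_process :: "'a measure \<Rightarrow> (real \<Rightarrow> 'a \<Rightarrow> real) \<Rightarrow> bool" where
  "continuous_process M X \<longleftrightarrow> (AE \<omega> in M. continuous_on {0..} (\<lambda>s. X s \<omega>))"

definition standard_brownian_motion ::
  "'a measure \<Rightarrow> (real \<Rightarrow> 'a measure) \<Rightarrow> (real \<Rightarrow> 'a \<Rightarrow> real) \<Rightarrow> bool" where
  "standard_brownian_motion M F B \<longleftrightarrow>
     prob_space M \<and>
     filtration (space M) F \<and> (\<forall>s. sets (F s) \<subseteq> sets M) \<and>
     adapted_process F B \<and> continuous_process M B \<and>
     (AE \<omega> in M. B 0 \<omega> = 0) \<and>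
     (\<forall>s u. 0 \<le> s \<and> s < u \<longrightarrow>
        distributed M lborel (\<lambda>\<omega>. B u \<omega> - B s \<omega>) (normal_density 0 (sqrt (u - s))) \<and>
        prob_space.indep_set M (sets (F s))
          {(\<lambda>\<omega>. B u \<omega> - B s \<omega>) -` A \<inter> space M |A. A \<in> sets borel})"

definition interval_partition :: "real \<Rightarrow> nat \<Rightarrow> (nat \<Rightarrow> real) \<Rightarrow> bool" where
  "interval_partition t n p \<longleftrightarrow> p 0 = 0 \<and> p n = t \<and> (\<forall>i<n. p i \<le> p (Suc i))"

text \<open>The Ito integral \<open>I = \<integral>\<^sub>0\<^sup>t H dB\<close> of a continuous adapted integrand: the limit in
  probability of the left-endpoint sums as the mesh of the partition tends to zero.
  Measurability of \<open>I\<close> is required since \<^const>\<open>measure\<close> is \<open>0\<close> on non-measurable sets.\<close>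

definition has_ito_integral ::
  "'a measure \<Rightarrow> (real \<Rightarrow> 'a measure) \<Rightarrow> (real \<Rightarrow> 'a \<Rightarrow> real) \<Rightarrow> (real \<Rightarrow> 'a \<Rightarrow> real) \<Rightarrow>
   real \<Rightarrow> ('a \<Rightarrow> real) \<Rightarrow> bool" where
  "has_ito_integral M F B H t I \<longleftrightarrow>
     adapted_process F H \<and> continuous_process M H \<and> I \<in> borel_measurable M \<and>
     (\<forall>\<epsilon>>0. \<forall>\<eta>>0. \<exists>\<delta>>0. \<forall>n p.
        interval_partition t n p \<and> (\<forall>i<n. p (Suc i) - p i < \<delta>) \<longrightarrow>
        measure M {\<omega> \<in> space M.
          \<bar>(\<Sum>i<n. H (p i) \<omega> * (B (p (Suc i)) \<omega> - B (p i) \<omega>)) - I \<omega>\<bar> > \<epsilon>} < \<eta>)"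

text \<open>\<open>dP\<^sub>t / P\<^sub>t = g dt + \<sigma> dB\<^sub>t\<close> with deterministic initial value \<open>P0\<close>, as an integral
  equation.  Positivity gives meaning to the division by \<open>P\<^sub>t\<close>.\<close>

definition lst_price_process ::
  "'a measure \<Rightarrow> (real \<Rightarrow> 'a measure) \<Rightarrow> (real \<Rightarrow> 'a \<Rightarrow> real) \<Rightarrow> real \<Rightarrow> real \<Rightarrow> real \<Rightarrow>
   (real \<Rightarrow> 'a \<Rightarrow> real) \<Rightarrow> bool" where
  "lst_price_process M F B g \<sigma> P0 P \<longleftrightarrow>
     adapted_process F P \<and> continuous_process M P \<and>
     (AE \<omega> in M. P 0 \<omega> = P0) \<and>
     (AE \<omega> in M. \<forall>s\<ge>0. P s \<omega> > 0) \<and>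
     (\<forall>t\<ge>0. \<exists>I. has_ito_integral M F B (\<lambda>s \<omega>. \<sigma> * P s \<omega>) t I \<and>
        (AE \<omega> in M. P t \<omega> = P 0 \<omega> + integral {0..t} (\<lambda>s. g * P s \<omega>) + I \<omega>))"

definition exit_discount :: "real \<Rightarrow> real \<Rightarrow> real" where
  "exit_discount m t = exp (- m * t)"

definition rebasing :: "real \<Rightarrow> real \<Rightarrow> real \<Rightarrow> bool" where
  "rebasing P0 g r \<longleftrightarrow> P0 = 1 \<and> g = 0 \<and> r > 0"

definition reward_bearing :: "real \<Rightarrow> real \<Rightarrow> real \<Rightarrow> bool" where
  "reward_bearing P0 g r \<longleftrightarrow> P0 > 1 \<and> g > 0 \<and> r = 0"

definition discounted_fees :: "real \<Rightarrow> (real \<Rightarrow> real) \<Rightarrow> real \<Rightarrow> real" where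
  "discounted_fees \<rho> \<phi> t = integral {0..t} (\<lambda>s. \<phi> s * exp (- \<rho> * s))"

definition investor_objective ::
  "'a measure \<Rightarrow> (real \<Rightarrow> 'a \<Rightarrow> real) \<Rightarrow> real \<Rightarrow> real \<Rightarrow> real \<Rightarrow> real \<Rightarrow> (real \<Rightarrow> real) \<Rightarrow> real \<Rightarrow>
   real \<times> real \<Rightarrow> real" where
  "investor_objective M P P0 r m \<rho> \<phi> t = (\<lambda>(x, a).
     (- exp (- \<rho> * t) * (\<integral>\<omega>. (sqrt (exit_discount m t * P t \<omega>) - sqrt P0)\<^sup>2 \<partial>M)
        + discounted_fees \<rho> \<phi> t) * x
     - exp (- \<rho> * t) * ((\<integral>\<omega>. exit_discount m t * P t \<omega> \<partial>M) * exp (r * t) / P0 - 1) * a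
     + exp (- \<rho> * t) * ((\<integral>\<omega>. exit_discount m t * P t \<omega> \<partial>M) * exp (r * t) / P0))"

definition feasible_allocation :: "real \<Rightarrow> real \<times> real \<Rightarrow> bool" where
  "feasible_allocation P0 = (\<lambda>(x, a).
     P0 * x \<le> a \<and> a \<le> 1 - P0 * x \<and> 0 \<le> x \<and> x \<le> 1 / (2 * P0))"

definition optimal_allocation ::
  "'a measure \<Rightarrow> (real \<Rightarrow> 'a \<Rightarrow> real) \<Rightarrow> real \<Rightarrow> real \<Rightarrow> real \<Rightarrow> real \<Rightarrow> (real \<Rightarrow> real) \<Rightarrow> real \<Rightarrow>
   real \<times> real \<Rightarrow> bool" where
  "optimal_allocation M P P0 r m \<rho> \<phi> t =
     is_arg_max (investor_objective M P P0 r m \<rho> \<phi> t) (feasible_allocation P0)"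

definition chosen_allocation ::
  "'a measure \<Rightarrow> (real \<Rightarrow> 'a \<Rightarrow> real) \<Rightarrow> real \<Rightarrow> real \<Rightarrow> real \<Rightarrow> real \<Rightarrow> (real \<Rightarrow> real) \<Rightarrow> real \<Rightarrow>
   real \<times> real \<Rightarrow> bool" where
  "chosen_allocation M P P0 r m \<rho> \<phi> t = (\<lambda>(x, a).
     optimal_allocation M P P0 r m \<rho> \<phi> t (x, a) \<and>
     ((\<forall>x'\<in>{0..1 / (2 * P0)}. \<exists>a'. optimal_allocation M P P0 r m \<rho> \<phi> t (x', a')) \<longrightarrow> x = 0) \<and>
     ((\<forall>a'\<in>{0..1}. \<exists>x'. optimal_allocation M P P0 r m \<rho> \<phi> t (x', a')) \<longrightarrow> a = 0))"

definition fee_threshold ::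
  "real \<Rightarrow> real \<Rightarrow> real \<Rightarrow> real \<Rightarrow> real \<Rightarrow> real \<Rightarrow> real \<Rightarrow> real" where
  "fee_threshold P0 g \<sigma> r m \<rho> t =
     P0 * (exp ((g - m - \<rho>) * t) * (exp (r * t) + 1)
           - 2 * exp ((1/2 * g - 1/8 * \<sigma>\<^sup>2 - 1/2 * m - \<rho>) * t))"

end

theory Submission
  imports Defs "HOL-Real_Asymp.Real_Asymp"
begin

text \<open>The price is a geometric Brownian motion,
  \<open>P\<^sub>t = P\<^sub>0 exp ((g - \<sigma>\<^sup>2/2) t + \<sigma> B\<^sub>t)\<close>, which is derived directly from the Riemann-sum
  definition of the Ito integral.  On a grid with \<open>N\<close> cells write the relative increments as
  \<open>u\<^sub>k = \<Delta>P\<^sub>k / P\<^sub>k = (g \<integral> P ds) / P\<^sub>k + \<sigma> \<Delta>B\<^sub>k + e\<^sub>k\<close>.  Then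
  \<open>ln P\<^sub>t - ln P\<^sub>0 = \<Sum> ln (1 + u\<^sub>k) = \<Sum> u\<^sub>k - \<Sum> u\<^sub>k\<^sup>2 / 2 + o(1)\<close>, and this tends to
  \<open>g t + \<sigma> B\<^sub>t - \<sigma>\<^sup>2 t / 2\<close> as soon as \<open>\<Sum> (\<Delta>B\<^sub>k)\<^sup>2 \<rightarrow> t\<close>, \<open>\<Sum> e\<^sub>k \<rightarrow> 0\<close> and \<open>\<Sum> e\<^sub>k\<^sup>2 \<rightarrow> 0\<close>
  along a subsequence.  To bound \<open>e\<^sub>k\<close>, each increment of the Ito integral is replaced by a Riemann
  sum over a much finer grid, so that \<open>e\<^sub>k\<close> becomes a discrete stochastic integral of
  \<open>\<sigma> (P\<^sub>q / P\<^sub>k - 1)\<close>.  By uniform continuity of the paths this integrand is at most \<open>\<eta>\<close> with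
  probability tending to \<open>1\<close>; after clipping it at \<open>\<eta>\<close>, the discrete Ito isometry bounds both sums
  by \<open>\<eta>\<^sup>2 t\<close> in expectation.

  The lognormal moments make the objective explicit.  The coefficient of \<open>a\<close> is negative, so
  \<open>a = P\<^sub>0 x\<close> at an optimum, and what remains is linear in \<open>x\<close> with slope equal to the discounted
  fees minus the threshold.  If the slope is zero every \<open>x\<close> is optimal and the tie-breaking rule
  selects \<open>x = 0\<close>.\<close>

subsection \<open>Pathwise logarithm\<close>

lemma continuous_on_interval_positive_lower_bound:
  fixes p :: "real \<Rightarrow> real"
  assumes "continuous_on {0..T} p" and "\<And>s. s \<in> {0..T} \<Longrightarrow> p s > 0" and "T \<ge> 0"
  obtains c where "c > 0" "\<And>s. s \<in> {0..T} \<Longrightarrow> p s \<ge> c"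
proof -
  obtain z where "z \<in> {0..T}" "\<forall>y\<in>{0..T}. p z \<le> p y"
    using continuous_attains_inf[of "{0..T}" p] assms by auto
  then show thesis using that[of "p z"] assms by auto
qed

text \<open>Uniform continuity bounds absolute differences; dividing by the positive minimum of
  \<open>p\<close> turns this into a bound on relative ones.\<close>

lemma continuous_on_interval_ratio_close:
  fixes p :: "real \<Rightarrow> real"
  assumes cont: "continuous_on {0..T} p" and pos: "\<And>s. s \<in> {0..T} \<Longrightarrow> p s > 0"
    and "T \<ge> 0" "\<eta> > 0"
  shows "\<exists>\<delta>>0. \<forall>s\<in>{0..T}. \<forall>u\<in>{0..T}. \<bar>s - u\<bar> < \<delta> \<longrightarrow> \<bar>p s / p u - 1\<bar> \<le> \<eta>"
proof -
  obtain c where c: "c > 0" "\<And>s. s \<in> {0..T} \<Longrightarrow> p s \<ge> c"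
    using continuous_on_interval_positive_lower_bound[OF cont pos] \<open>T \<ge> 0\<close> by blast
  have "uniformly_continuous_on {0..T} p"
    using cont by (intro compact_uniformly_continuous) auto
  then obtain \<delta> where d: "\<delta> > 0"
    "\<And>s u. s \<in> {0..T} \<Longrightarrow> u \<in> {0..T} \<Longrightarrow> dist u s < \<delta> \<Longrightarrow> dist (p u) (p s) < \<eta> * c"
    unfolding uniformly_continuous_on_def using \<open>\<eta> > 0\<close> c(1) by (metis mult_pos_pos)
  have "\<bar>p s / p u - 1\<bar> \<le> \<eta>" if su: "s \<in> {0..T}" "u \<in> {0..T}" "\<bar>s - u\<bar> < \<delta>" for s u
  proof -
    have "\<bar>p s - p u\<bar> < \<eta> * c" using d(2)[of u s] su by (simp add: dist_real_def)
    also have "\<dots> \<le> \<eta> * p u" using c(2)[OF su(2)] \<open>\<eta> > 0\<close> by simp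
    finally have "\<bar>p s - p u\<bar> / p u \<le> \<eta>" using pos[OF su(2)] by (simp add: divide_le_eq)
    moreover have "p s / p u - 1 = (p s - p u) / p u" using pos[OF su(2)] by (simp add: field_simps)
    ultimately show ?thesis using pos[OF su(2)] by simp
  qed
  then show ?thesis using d(1) by blast
qed

text \<open>Since 1/(1+y) - 1 + y = y^2/(1+y), the remainder has derivative at most 2 x^2 on
  [-|x|, |x|], because 1 + y >= 1/2 there; the mean value inequality supplies the third factor
  |x|.\<close>

lemma abs_ln_one_plus_second_order_bound:
  fixes x :: real
  assumes "\<bar>x\<bar> \<le> 1 / 2"
  shows "\<bar>ln (1 + x) - x + x\<^sup>2 / 2\<bar> \<le> 2 * \<bar>x\<bar> ^ 3"
proof -
  define f where "f y = ln (1 + y) - y + y\<^sup>2 / 2" for y :: real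
  have "norm (f x - f 0) \<le> (2 * x\<^sup>2) * norm (x - 0)"
  proof (rule field_differentiable_bound[where S = "{-\<bar>x\<bar>..\<bar>x\<bar>}" and f' = "\<lambda>y. y\<^sup>2 / (1 + y)"])
    fix y assume y: "y \<in> {-\<bar>x\<bar>..\<bar>x\<bar>}"
    with assms have y': "1 + y \<ge> 1 / 2" "\<bar>y\<bar> \<le> \<bar>x\<bar>" by auto
    show "(f has_field_derivative y\<^sup>2 / (1 + y)) (at y within {-\<bar>x\<bar>..\<bar>x\<bar>})"
      unfolding f_def using y'(1)
      by (auto intro!: derivative_eq_intros simp: field_simps power2_eq_square)
    have "y\<^sup>2 \<le> x\<^sup>2" using y'(2) by (simp add: abs_le_square_iff)
    then have "y\<^sup>2 / (1 + y) \<le> x\<^sup>2 / (1 / 2)" using y'(1) by (intro frac_le) auto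
    then show "norm (y\<^sup>2 / (1 + y)) \<le> 2 * x\<^sup>2" using y'(1) by simp
  qed auto
  then show ?thesis by (simp add: f_def power3_eq_cube power2_eq_square abs_mult)
qed

text \<open>Cauchy-Schwarz on each row: the squared sum is at most a product of square sums, one of
  which vanishes.\<close>

lemma tendsto_sum_mult_zero:
  fixes a b :: "nat \<Rightarrow> nat \<Rightarrow> real"
  assumes "(\<lambda>n. \<Sum>k<N n. (a n k)\<^sup>2) \<longlonglongrightarrow> 0" and "(\<lambda>n. \<Sum>k<N n. (b n k)\<^sup>2) \<longlonglongrightarrow> l"
  shows "(\<lambda>n. \<Sum>k<N n. a n k * b n k) \<longlonglongrightarrow> 0"
proof -
  have "(\<lambda>n. (\<Sum>k<N n. (a n k)\<^sup>2) * (\<Sum>k<N n. (b n k)\<^sup>2)) \<longlonglongrightarrow> 0"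
    using tendsto_mult[OF assms] by simp
  then have "(\<lambda>n. (\<Sum>k<N n. a n k * b n k)\<^sup>2) \<longlonglongrightarrow> 0"
    by (rule tendsto_sandwich[OF _ _ tendsto_const, rotated 2])
       (auto intro!: always_eventually Cauchy_Schwarz_ineq_sum)
  then show ?thesis by simp
qed

text \<open>Expanding the square leaves a cross term that vanishes by Cauchy-Schwarz, so a
  perturbation negligible in square sum does not change the quadratic variation.\<close>

lemma tendsto_sum_add_square_zero:
  fixes a b :: "nat \<Rightarrow> nat \<Rightarrow> real"
  assumes "(\<lambda>n. \<Sum>k<N n. (a n k)\<^sup>2) \<longlonglongrightarrow> 0" and "(\<lambda>n. \<Sum>k<N n. (b n k)\<^sup>2) \<longlonglongrightarrow> l"
  shows "(\<lambda>n. \<Sum>k<N n. (a n k + b n k)\<^sup>2) \<longlonglongrightarrow> l"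
proof -
  have "(\<lambda>n. (\<Sum>k<N n. (a n k)\<^sup>2) + 2 * (\<Sum>k<N n. a n k * b n k) + (\<Sum>k<N n. (b n k)\<^sup>2))
      \<longlonglongrightarrow> 0 + 2 * 0 + l"
    by (intro tendsto_intros assms tendsto_sum_mult_zero[OF assms])
  then show ?thesis
    by (simp add: power2_sum sum.distrib sum_distrib_left algebra_simps)
qed

text \<open>The deterministic half of the argument, for a single path: all probability is packed
  into the three limits \<open>qv\<close>, \<open>e1\<close> and \<open>e2\<close>. The grid sizes
  \<open>N n\<close> are left general so that a subsequence of grids can be supplied.\<close>

lemma log_path_limit:
  fixes p b :: "real \<Rightarrow> real" and N :: "nat \<Rightarrow> nat" and e :: "nat \<Rightarrow> nat \<Rightarrow> real"
    and g \<sigma> T :: real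
  defines "\<tau> n k \<equiv> T * real k / real (N n)"
  assumes cont: "continuous_on {0..T} p" and pos: "\<And>s. s \<in> {0..T} \<Longrightarrow> p s > 0" and T: "T > 0"
    and N: "filterlim N at_top sequentially" and N0: "\<And>n. N n > 0"
    and step: "\<And>n k. k < N n \<Longrightarrow> p (\<tau> n (Suc k)) - p (\<tau> n k)
      = integral {\<tau> n k..\<tau> n (Suc k)} (\<lambda>s. g * p s)
        + p (\<tau> n k) * (\<sigma> * (b (\<tau> n (Suc k)) - b (\<tau> n k)) + e n k)"
    and qv: "(\<lambda>n. \<Sum>k<N n. (b (\<tau> n (Suc k)) - b (\<tau> n k))\<^sup>2) \<longlonglongrightarrow> T"
    and e1: "(\<lambda>n. \<Sum>k<N n. e n k) \<longlonglongrightarrow> 0"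
    and e2: "(\<lambda>n. \<Sum>k<N n. (e n k)\<^sup>2) \<longlonglongrightarrow> 0"
  shows "ln (p T) - ln (p 0) = (g - \<sigma>\<^sup>2 / 2) * T + \<sigma> * (b T - b 0)"
proof -
  have \<tau>_in: "\<tau> n k \<in> {0..T}" if "k \<le> N n" for n k
    using that T N0[of n] by (auto simp: \<tau>_def field_simps)
  have \<tau>_diff: "\<tau> n (Suc k) - \<tau> n k = T / N n" for n k
    by (simp add: \<tau>_def distrib_left add_divide_distrib)
  have \<tau>_le: "\<tau> n k \<le> \<tau> n (Suc k)" for n k
    using T by (simp add: \<tau>_def divide_right_mono)
  have \<tau>_ends: "\<tau> n 0 = 0" "\<tau> n (N n) = T" for n
    using N0[of n] by (auto simp: \<tau>_def)
  have mesh: "(\<lambda>n. T / N n) \<longlonglongrightarrow> 0"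
    by (intro real_tendsto_divide_at_top[OF tendsto_const] filterlim_compose[OF filterlim_real_sequentially N])
  have close: "\<forall>\<^sub>F n in sequentially. \<forall>k<N n. \<forall>s\<in>{\<tau> n k..\<tau> n (Suc k)}. \<bar>p s / p (\<tau> n k) - 1\<bar> \<le> \<eta>"
    if \<eta>: "\<eta> > 0" for \<eta>
  proof -
    obtain \<delta> where d: "\<delta> > 0"
      "\<forall>s\<in>{0..T}. \<forall>u\<in>{0..T}. \<bar>s - u\<bar> < \<delta> \<longrightarrow> \<bar>p s / p u - 1\<bar> \<le> \<eta>"
      using continuous_on_interval_ratio_close[OF cont pos _ \<eta>] T by auto
    have "\<forall>\<^sub>F n in sequentially. T / N n < \<delta>"
      using order_tendstoD(2)[OF mesh d(1)] .
    then show ?thesis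
    proof eventually_elim
      case (elim n)
      show ?case
      proof (intro allI impI ballI)
        fix k s assume k: "k < N n" and s: "s \<in> {\<tau> n k..\<tau> n (Suc k)}"
        have "\<bar>s - \<tau> n k\<bar> < \<delta>" using s \<tau>_diff[of n k] elim by auto
        moreover have "s \<in> {0..T}" "\<tau> n k \<in> {0..T}"
          using s \<tau>_in[of k n] \<tau>_in[of "Suc k" n] k by auto
        ultimately show "\<bar>p s / p (\<tau> n k) - 1\<bar> \<le> \<eta>" using d(2) by blast
      qed
    qed
  qed
  \<comment> \<open>The relative increment \<open>u\<close> over a cell splits into drift
    \<open>a\<close>, noise \<open>v\<close> and error \<open>e\<close>.\<close>
  define a where "a n k = integral {\<tau> n k..\<tau> n (Suc k)} (\<lambda>s. g * p s) / p (\<tau> n k)" for n k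
  define v where "v n k = \<sigma> * (b (\<tau> n (Suc k)) - b (\<tau> n k))" for n k
  define u where "u n k = p (\<tau> n (Suc k)) / p (\<tau> n k) - 1" for n k
  have u_eq: "u n k = a n k + e n k + v n k" if "k < N n" for n k
  proof -
    have "p (\<tau> n k) > 0" using that by (intro pos \<tau>_in) auto
    then show ?thesis using step[OF that] by (simp add: u_def a_def v_def field_simps)
  qed
  \<comment> \<open>With the division by the left-endpoint price taken inside the integral, the
    deviation has integrand \<open>g * (p s / p (\<tau> n k) - 1)\<close>, bounded through
    \<open>close\<close>.\<close>
  have a_close: "\<forall>\<^sub>F n in sequentially. \<forall>k<N n. \<bar>a n k - g * (T / N n)\<bar> \<le> \<bar>g\<bar> * \<eta> * (T / N n)"
    if "\<eta> > 0" for \<eta>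
    using close[OF that]
  proof eventually_elim
    case (elim n)
    show ?case
    proof (intro allI impI)
      fix k assume k: "k < N n"
      have pk: "p (\<tau> n k) > 0" using k by (intro pos \<tau>_in) auto
      have sub: "{\<tau> n k..\<tau> n (Suc k)} \<subseteq> {0..T}"
        using \<tau>_in[of k n] \<tau>_in[of "Suc k" n] k by auto
      have c: "continuous_on {\<tau> n k..\<tau> n (Suc k)} p" using cont sub continuous_on_subset by blast
      have "a n k - g * (T / N n)
          = integral {\<tau> n k..\<tau> n (Suc k)} (\<lambda>s. g * (p s / p (\<tau> n k) - 1))"
      proof -
        have "integral {\<tau> n k..\<tau> n (Suc k)} (\<lambda>s. g * (p s / p (\<tau> n k) - 1))
            = integral {\<tau> n k..\<tau> n (Suc k)} (\<lambda>s. g * p s / p (\<tau> n k))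
              - integral {\<tau> n k..\<tau> n (Suc k)} (\<lambda>s. g)"
          using pk c by (subst integral_diff[symmetric])
            (auto intro!: integrable_continuous_interval continuous_intros integral_cong simp: algebra_simps)
        moreover have "integral {\<tau> n k..\<tau> n (Suc k)} (\<lambda>s. g) = g * (T / N n)"
          using \<tau>_le[of n k] \<tau>_diff[of n k] by simp
        ultimately show ?thesis by (simp add: a_def)
      qed
      moreover have "norm (integral {\<tau> n k..\<tau> n (Suc k)} (\<lambda>s. g * (p s / p (\<tau> n k) - 1)))
          \<le> (\<bar>g\<bar> * \<eta>) * (\<tau> n (Suc k) - \<tau> n k)"
        using pk c elim k \<tau>_le
        by (intro integral_bound) (auto intro!: continuous_intros mult_left_mono simp: abs_mult)
      ultimately show "\<bar>a n k - g * (T / N n)\<bar> \<le> \<bar>g\<bar> * \<eta> * (T / N n)"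
        by (simp add: \<tau>_diff)
    qed
  qed
  have sum_a: "(\<lambda>n. \<Sum>k<N n. a n k) \<longlonglongrightarrow> g * T"
  proof (rule LIMSEQ_I)
    fix r :: real assume r: "r > 0"
    \<comment> \<open>The summand 1 keeps the denominator positive when g = 0; the factor 2 leaves
      slack for the strict inequality.\<close>
    define \<eta> where "\<eta> = r / (2 * (\<bar>g\<bar> * T + 1))"
    have gT: "\<bar>g\<bar> * T + 1 > 0" using T by (simp add: add_nonneg_pos)
    have \<eta>: "\<eta> > 0" using r gT by (simp add: \<eta>_def)
    have "\<forall>\<^sub>F n in sequentially. norm ((\<Sum>k<N n. a n k) - g * T) < r"
      using a_close[OF \<eta>]
    proof eventually_elim
      case (elim n)
      have "(\<Sum>k<N n. a n k) - g * T = (\<Sum>k<N n. a n k - g * (T / N n))"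
        using N0[of n] by (simp add: sum_subtractf)
      also have "norm \<dots> \<le> (\<Sum>k<N n. \<bar>g\<bar> * \<eta> * (T / N n))"
        using elim by (intro sum_norm_le) auto
      also have "\<dots> = \<bar>g\<bar> * T * \<eta>" using N0[of n] by simp
      also have "\<dots> < (\<bar>g\<bar> * T + 1) * \<eta>" using \<eta> by simp
      also have "\<dots> \<le> (\<bar>g\<bar> * T + 1) * (2 * \<eta>)" using \<eta> gT by simp
      also have "\<dots> = r" unfolding \<eta>_def using gT by (simp add: field_simps)
      finally show ?case .
    qed
    then show "\<exists>no. \<forall>n\<ge>no. norm ((\<Sum>k<N n. a n k) - g * T) < r"
      by (simp add: eventually_sequentially)
  qed
  \<comment> \<open>Taking \<eta> = 1 in \<open>a_close\<close> gives |a| <= 2|g| T/N, so N squares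
    add up to order 1/N.\<close>
  have sum_a2: "(\<lambda>n. \<Sum>k<N n. (a n k)\<^sup>2) \<longlonglongrightarrow> 0"
  proof (rule tendsto_sandwich[OF _ _ tendsto_const])
    show "(\<lambda>n. (2 * \<bar>g\<bar>)\<^sup>2 * T * (T / N n)) \<longlonglongrightarrow> 0"
      using tendsto_mult_left[OF mesh, of "(2 * \<bar>g\<bar>)\<^sup>2 * T"] by simp
    show "\<forall>\<^sub>F n in sequentially. (\<Sum>k<N n. (a n k)\<^sup>2) \<le> (2 * \<bar>g\<bar>)\<^sup>2 * T * (T / N n)"
      using a_close[OF zero_less_one]
    proof eventually_elim
      case (elim n)
      have "(\<Sum>k<N n. (a n k)\<^sup>2) \<le> (\<Sum>k<N n. (2 * \<bar>g\<bar> * (T / N n))\<^sup>2)"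
      proof (rule sum_mono)
        fix k assume "k \<in> {..<N n}"
        then have "\<bar>a n k - g * (T / N n)\<bar> \<le> \<bar>g\<bar> * (T / N n)" using elim by auto
        moreover have "\<bar>g * (T / N n)\<bar> = \<bar>g\<bar> * (T / N n)" using T by (simp add: abs_mult)
        moreover have "\<bar>z\<bar> \<le> \<bar>2 * w\<bar>" if "\<bar>z - y\<bar> \<le> w" "\<bar>y\<bar> = w" for z y w :: real
          using that by linarith
        ultimately have "\<bar>a n k\<bar> \<le> \<bar>2 * \<bar>g\<bar> * (T / N n)\<bar>"
          by (metis mult.assoc)
        then show "(a n k)\<^sup>2 \<le> (2 * \<bar>g\<bar> * (T / N n))\<^sup>2"
          by (simp only: abs_le_square_iff)
      qed
      also have "\<dots> = (2 * \<bar>g\<bar>)\<^sup>2 * T * (T / N n)"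
        using N0[of n] by (simp add: power2_eq_square field_simps)
      finally show ?case .
    qed
  qed (auto intro!: always_eventually sum_nonneg)
  have sum_v: "(\<Sum>k<N n. v n k) = \<sigma> * (b T - b 0)" for n
    using sum_lessThan_telescope[of "\<lambda>k. b (\<tau> n k)" "N n"]
    by (simp add: v_def sum_distrib_left[symmetric] \<tau>_ends)
  have sum_v2: "(\<lambda>n. \<Sum>k<N n. (v n k)\<^sup>2) \<longlonglongrightarrow> \<sigma>\<^sup>2 * T"
    using tendsto_mult_left[OF qv, of "\<sigma>\<^sup>2"] by (simp add: v_def power_mult_distrib sum_distrib_left)
  have sum_u: "(\<lambda>n. \<Sum>k<N n. u n k) \<longlonglongrightarrow> g * T + 0 + \<sigma> * (b T - b 0)"
  proof -
    have "(\<lambda>n. (\<Sum>k<N n. a n k) + (\<Sum>k<N n. e n k) + \<sigma> * (b T - b 0))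
        \<longlonglongrightarrow> g * T + 0 + \<sigma> * (b T - b 0)"
      by (intro tendsto_intros sum_a e1)
    moreover have "(\<Sum>k<N n. a n k) + (\<Sum>k<N n. e n k) + \<sigma> * (b T - b 0) = (\<Sum>k<N n. u n k)" for n
      using u_eq by (simp add: sum_v[symmetric, of n] sum.distrib[symmetric])
    ultimately show ?thesis by simp
  qed
  have sum_u2: "(\<lambda>n. \<Sum>k<N n. (u n k)\<^sup>2) \<longlonglongrightarrow> \<sigma>\<^sup>2 * T"
    using tendsto_sum_add_square_zero[OF tendsto_sum_add_square_zero[OF sum_a2 e2] sum_v2] u_eq
    by simp
  have logs: "(\<Sum>k<N n. ln (1 + u n k)) = ln (p T) - ln (p 0)" for n
  proof -
    have "(\<Sum>k<N n. ln (1 + u n k)) = (\<Sum>k<N n. ln (p (\<tau> n (Suc k))) - ln (p (\<tau> n k)))"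
    proof (rule sum.cong)
      fix k assume "k \<in> {..<N n}"
      then have "p (\<tau> n k) > 0" "p (\<tau> n (Suc k)) > 0" by (auto intro!: pos \<tau>_in)
      then show "ln (1 + u n k) = ln (p (\<tau> n (Suc k))) - ln (p (\<tau> n k))"
        by (simp add: u_def ln_div)
    qed simp
    then show ?thesis
      using sum_lessThan_telescope[of "\<lambda>k. ln (p (\<tau> n k))" "N n"] by (simp add: \<tau>_ends)
  qed
  have "(\<lambda>n. \<Sum>k<N n. ln (1 + u n k) - u n k + (u n k)\<^sup>2 / 2) \<longlonglongrightarrow> 0"
  proof (rule LIMSEQ_I)
    fix r :: real assume r: "r > 0"
    \<comment> \<open>The bound 1/2 admits the expansion of the logarithm. The other makes the cubic
      remainder, at most 2\<eta> times the square sum, smaller than r, because the square sum is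
      eventually below \<sigma>^2 T + 1.\<close>
    define \<eta> where "\<eta> = min (1 / 2) (r / (2 * (\<sigma>\<^sup>2 * T + 1)))"
    have gT: "\<sigma>\<^sup>2 * T + 1 > 0" using T by (simp add: add_nonneg_pos)
    have \<eta>: "\<eta> > 0" "\<eta> \<le> 1 / 2" "2 * \<eta> * (\<sigma>\<^sup>2 * T + 1) \<le> r"
    proof -
      show "\<eta> > 0" using r gT by (simp add: \<eta>_def)
      show "\<eta> \<le> 1 / 2" unfolding \<eta>_def by (rule min.cobounded1)
      have "\<eta> \<le> r / (2 * (\<sigma>\<^sup>2 * T + 1))" by (simp add: \<eta>_def)
      then show "2 * \<eta> * (\<sigma>\<^sup>2 * T + 1) \<le> r" using gT by (simp add: field_simps)
    qed
    have "\<forall>\<^sub>F n in sequentially. (\<Sum>k<N n. (u n k)\<^sup>2) < \<sigma>\<^sup>2 * T + 1"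
      using order_tendstoD(2)[OF sum_u2] by simp
    with close[OF \<eta>(1)]
    have "\<forall>\<^sub>F n in sequentially. norm ((\<Sum>k<N n. ln (1 + u n k) - u n k + (u n k)\<^sup>2 / 2) - 0) < r"
    proof eventually_elim
      case (elim n)
      have "norm (\<Sum>k<N n. ln (1 + u n k) - u n k + (u n k)\<^sup>2 / 2) \<le> (\<Sum>k<N n. 2 * \<eta> * (u n k)\<^sup>2)"
      proof (rule sum_norm_le)
        fix k assume k: "k \<in> {..<N n}"
        then have uk: "\<bar>u n k\<bar> \<le> \<eta>" using elim(1) \<tau>_le[of n k] by (auto simp: u_def)
        have "\<bar>ln (1 + u n k) - u n k + (u n k)\<^sup>2 / 2\<bar> \<le> 2 * \<bar>u n k\<bar> ^ 3"
          using uk \<eta> by (intro abs_ln_one_plus_second_order_bound) auto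
        also have "\<dots> = 2 * \<bar>u n k\<bar> * (u n k)\<^sup>2" by (simp add: power3_eq_cube power2_eq_square)
        also have "\<dots> \<le> 2 * \<eta> * (u n k)\<^sup>2" using uk by (intro mult_right_mono) auto
        finally show "norm (ln (1 + u n k) - u n k + (u n k)\<^sup>2 / 2) \<le> 2 * \<eta> * (u n k)\<^sup>2" by simp
      qed
      also have "\<dots> = 2 * \<eta> * (\<Sum>k<N n. (u n k)\<^sup>2)" by (simp add: sum_distrib_left)
      also have "\<dots> < 2 * \<eta> * (\<sigma>\<^sup>2 * T + 1)" using elim(2) \<eta>(1) by simp
      also note \<eta>(3)
      finally show ?case by simp
    qed
    then show "\<exists>no. \<forall>n\<ge>no. norm ((\<Sum>k<N n. ln (1 + u n k) - u n k + (u n k)\<^sup>2 / 2) - 0) < r"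
      by (simp add: eventually_sequentially)
  qed
  \<comment> \<open>By \<open>logs\<close> the sum of logarithms telescopes to a constant sequence,
    so its limit is the value itself.\<close>
  from tendsto_add[OF this tendsto_diff[OF sum_u tendsto_divide[OF sum_u2 tendsto_const, of 2]]]
  have "(\<lambda>n. ln (p T) - ln (p 0)) \<longlonglongrightarrow> g * T + \<sigma> * (b T - b 0) - \<sigma>\<^sup>2 * T / 2"
    by (simp add: sum.distrib sum_subtractf logs sum_divide_distrib)
  then have "ln (p T) - ln (p 0) = g * T + \<sigma> * (b T - b 0) - \<sigma>\<^sup>2 * T / 2"
    by (simp add: LIMSEQ_const_iff)
  then show ?thesis by (simp add: algebra_simps)
qed

subsection \<open>Brownian increments\<close>

text \<open>The discrete Ito isometry as an inequality. The cross term has mean zero because S J is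
  known at stage n and X is independent of that stage and centred; boundedness of J secures
  integrability. Stages are abstract, so that grids started at any index fit, as do both Brownian
  increments and their centred squares.\<close>

lemma (in prob_space) martingale_transform_square_bound:
  fixes G :: "nat \<Rightarrow> 'a measure" and J X :: "nat \<Rightarrow> 'a \<Rightarrow> real" and \<eta> c :: real
  assumes G_mono: "\<And>i (Y :: 'a \<Rightarrow> real). Y \<in> borel_measurable (G i) \<Longrightarrow> Y \<in> borel_measurable (G (Suc i))"
    and G_M: "\<And>i (Y :: 'a \<Rightarrow> real). Y \<in> borel_measurable (G i) \<Longrightarrow> Y \<in> borel_measurable M"
    and J_meas: "\<And>i. J i \<in> borel_measurable (G i)"
    and X_meas: "\<And>i. X i \<in> borel_measurable (G (Suc i))"
    and indep: "\<And>i (Y :: 'a \<Rightarrow> real). Y \<in> borel_measurable (G i) \<Longrightarrow> indep_var borel Y borel (X i)"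
    and J_bound: "\<And>i \<omega>. \<bar>J i \<omega>\<bar> \<le> \<eta>"
    and X_sq: "\<And>i. integrable M (\<lambda>\<omega>. (X i \<omega>)\<^sup>2)"
    and X_mean: "\<And>i. expectation (X i) = 0"
    and X_var: "\<And>i. expectation (\<lambda>\<omega>. (X i \<omega>)\<^sup>2) \<le> c"
  shows "integrable M (\<lambda>\<omega>. (\<Sum>i<n. J i \<omega> * X i \<omega>)\<^sup>2)"
    and "expectation (\<lambda>\<omega>. (\<Sum>i<n. J i \<omega> * X i \<omega>)\<^sup>2) \<le> n * (\<eta>\<^sup>2 * c)"
proof -
  define S where "S n \<omega> = (\<Sum>i<n. J i \<omega> * X i \<omega>)" for n \<omega>
  have S_meas: "S n \<in> borel_measurable (G n)" for n
  proof (induction n)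
    case 0
    have "S 0 = (\<lambda>\<omega>. 0)" by (auto simp: S_def)
    then show ?case by simp
  next
    case (Suc n)
    have [measurable]: "S n \<in> borel_measurable (G (Suc n))" "J n \<in> borel_measurable (G (Suc n))"
      "X n \<in> borel_measurable (G (Suc n))"
      by (fact G_mono[OF Suc] G_mono[OF J_meas] X_meas)+
    have "S (Suc n) = (\<lambda>\<omega>. S n \<omega> + J n \<omega> * X n \<omega>)" by (auto simp: S_def)
    then show ?case by simp
  qed
  have "integrable M (\<lambda>\<omega>. (S n \<omega>)\<^sup>2) \<and> expectation (\<lambda>\<omega>. (S n \<omega>)\<^sup>2) \<le> n * (\<eta>\<^sup>2 * c)"
  proof (induction n)
    case 0
    then show ?case by (simp add: S_def)
  next
    case (Suc n)
    have [measurable]: "S n \<in> borel_measurable M" "J n \<in> borel_measurable M" "X n \<in> borel_measurable M"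
      "S n \<in> borel_measurable (G n)" "J n \<in> borel_measurable (G n)"
      by (fact G_M[OF S_meas] G_M[OF J_meas] G_M[OF X_meas] S_meas J_meas)+
    have X_int: "integrable M (X n)"
      by (rule square_integrable_imp_integrable) (use X_sq in auto)
    have S_int: "integrable M (S n)"
      by (rule square_integrable_imp_integrable) (use Suc in auto)
    have "\<bar>S n \<omega> * J n \<omega>\<bar> \<le> \<bar>\<eta> * S n \<omega>\<bar>" for \<omega>
      using mult_left_mono[OF order_trans[OF J_bound[of n \<omega>] abs_ge_self], of "\<bar>S n \<omega>\<bar>"]
      by (simp add: abs_mult mult.commute)
    then have SJ_int: "integrable M (\<lambda>\<omega>. S n \<omega> * J n \<omega>)"
      by (intro Bochner_Integration.integrable_bound[where f="\<lambda>\<omega>. \<eta> * S n \<omega>" and g="\<lambda>\<omega>. S n \<omega> * J n \<omega>"])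
         (use S_int in auto)
    have ind: "indep_var borel (\<lambda>\<omega>. S n \<omega> * J n \<omega>) borel (X n)"
      by (intro indep borel_measurable_times S_meas J_meas)
    have cross: "integrable M (\<lambda>\<omega>. (S n \<omega> * J n \<omega>) * X n \<omega>)"
      "expectation (\<lambda>\<omega>. (S n \<omega> * J n \<omega>) * X n \<omega>) = 0"
      using indep_var_integrable[OF ind SJ_int X_int]
        indep_var_lebesgue_integral[OF ind SJ_int X_int] X_mean by auto
    have le: "(J n \<omega> * X n \<omega>)\<^sup>2 \<le> \<eta>\<^sup>2 * (X n \<omega>)\<^sup>2" for \<omega>
      unfolding power_mult_distrib
      by (intro mult_right_mono) (use J_bound[of n \<omega>] in \<open>auto simp: abs_le_square_iff[symmetric]\<close>)
    have JX_int: "integrable M (\<lambda>\<omega>. (J n \<omega> * X n \<omega>)\<^sup>2)"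
      by (rule Bochner_Integration.integrable_bound[where f="\<lambda>\<omega>. \<eta>\<^sup>2 * (X n \<omega>)\<^sup>2"])
         (use X_sq le in auto)
    have "expectation (\<lambda>\<omega>. (J n \<omega> * X n \<omega>)\<^sup>2) \<le> expectation (\<lambda>\<omega>. \<eta>\<^sup>2 * (X n \<omega>)\<^sup>2)"
      by (rule integral_mono) (use JX_int X_sq le in auto)
    also have "\<dots> \<le> \<eta>\<^sup>2 * c" using X_var[of n] by (simp add: mult_left_mono)
    finally have var: "expectation (\<lambda>\<omega>. (J n \<omega> * X n \<omega>)\<^sup>2) \<le> \<eta>\<^sup>2 * c" .
    have eq: "(S (Suc n) \<omega>)\<^sup>2 = (S n \<omega>)\<^sup>2 + 2 * ((S n \<omega> * J n \<omega>) * X n \<omega>) + (J n \<omega> * X n \<omega>)\<^sup>2" for \<omega>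
      by (simp add: S_def power2_sum algebra_simps)
    show ?case
    proof (intro conjI)
      note I = integrable_mult_right[OF cross(1), of 2]
      show "integrable M (\<lambda>\<omega>. (S (Suc n) \<omega>)\<^sup>2)"
        unfolding eq
        by (intro Bochner_Integration.integrable_add conjunct1[OF Suc] I JX_int)
      have "expectation (\<lambda>\<omega>. (S (Suc n) \<omega>)\<^sup>2) = expectation (\<lambda>\<omega>. (S n \<omega>)\<^sup>2)
          + 2 * expectation (\<lambda>\<omega>. (S n \<omega> * J n \<omega>) * X n \<omega>) + expectation (\<lambda>\<omega>. (J n \<omega> * X n \<omega>)\<^sup>2)"
        unfolding eq
        by (simp add: Bochner_Integration.integral_add[OF Bochner_Integration.integrable_add]
              conjunct1[OF Suc] I JX_int cross(1))
      also have "\<dots> \<le> n * (\<eta>\<^sup>2 * c) + \<eta>\<^sup>2 * c"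
        using cross(2) Suc var by simp
      also have "\<dots> = Suc n * (\<eta>\<^sup>2 * c)" by (simp add: distrib_right)
      finally show "expectation (\<lambda>\<omega>. (S (Suc n) \<omega>)\<^sup>2) \<le> Suc n * (\<eta>\<^sup>2 * c)" .
    qed
  qed
  then show "integrable M (\<lambda>\<omega>. (\<Sum>i<n. J i \<omega> * X i \<omega>)\<^sup>2)"
    "expectation (\<lambda>\<omega>. (\<Sum>i<n. J i \<omega> * X i \<omega>)\<^sup>2) \<le> n * (\<eta>\<^sup>2 * c)"
    by (auto simp: S_def)
qed

text \<open>Completing the square: exponential tilting turns the centred normal density into a
  constant times the one with mean c s^2.\<close>

lemma (in prob_space) expectation_exp_normal:
  assumes D: "distributed M lborel X (normal_density 0 s)" and s: "s > 0"
  shows "integrable M (\<lambda>\<omega>. exp (c * X \<omega>))"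
    and "expectation (\<lambda>\<omega>. exp (c * X \<omega>)) = exp (c\<^sup>2 * s\<^sup>2 / 2)"
proof -
  have eq: "normal_density 0 s x * exp (c * x) = exp (c\<^sup>2 * s\<^sup>2 / 2) * normal_density (c * s\<^sup>2) s x" for x
  proof -
    have "- x\<^sup>2 / (2 * s\<^sup>2) + c * x = c\<^sup>2 * s\<^sup>2 / 2 + - (x - c * s\<^sup>2)\<^sup>2 / (2 * s\<^sup>2)"
      using s by (simp add: field_simps power2_eq_square)
    then show ?thesis
      by (simp add: normal_density_def mult_exp_exp)
  qed
  have "integrable lborel (\<lambda>x. normal_density 0 s x * exp (c * x))"
    unfolding eq using s by simp
  then show "integrable M (\<lambda>\<omega>. exp (c * X \<omega>))"
    by (subst (asm) distributed_integrable[OF D]) (auto simp: normal_density_nonneg)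
  have "expectation (\<lambda>\<omega>. exp (c * X \<omega>)) = (\<integral>x. normal_density 0 s x * exp (c * x) \<partial>lborel)"
    by (subst distributed_integral[OF D]) (auto simp: normal_density_nonneg)
  also have "\<dots> = exp (c\<^sup>2 * s\<^sup>2 / 2)" unfolding eq using s by simp
  finally show "expectation (\<lambda>\<omega>. exp (c * X \<omega>)) = exp (c\<^sup>2 * s\<^sup>2 / 2)" .
qed

section \<open>Brownian motion relative to a filtration: independence and moments of
  increments\<close>

locale brownian_motion =
  fixes M :: "'a measure" and F :: "real \<Rightarrow> 'a measure" and B :: "real \<Rightarrow> 'a \<Rightarrow> real"
  assumes standard_bm: "standard_brownian_motion M F B"
begin

sublocale prob_space M
  using standard_bm by (simp add: standard_brownian_motion_def)

lemma space_F: "space (F s) = space M"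
  using standard_bm by (simp add: standard_brownian_motion_def filtration_def)

lemma measurable_F_mono:
  assumes "Y \<in> borel_measurable (F s)" "s \<le> u"
  shows "Y \<in> borel_measurable (F u)"
proof (rule measurable_from_subalg[OF _ assms(1)])
  show "subalgebra (F u) (F s)"
    using standard_bm assms(2) unfolding standard_brownian_motion_def filtration_def
    by (simp add: subalgebra_def)
qed

lemma measurable_F_M:
  assumes "Y \<in> borel_measurable (F s)"
  shows "Y \<in> borel_measurable M"
proof (rule measurable_from_subalg[OF _ assms])
  show "subalgebra M (F s)"
    using standard_bm unfolding standard_brownian_motion_def filtration_def
    by (simp add: subalgebra_def)
qed

lemma B_measurable_F: "0 \<le> s \<Longrightarrow> s \<le> u \<Longrightarrow> B s \<in> borel_measurable (F u)"
  using standard_bm measurable_F_mono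
  unfolding standard_brownian_motion_def adapted_process_def by blast

lemma increment_distributed:
  "0 \<le> s \<Longrightarrow> s < u \<Longrightarrow>
    distributed M lborel (\<lambda>\<omega>. B u \<omega> - B s \<omega>) (normal_density 0 (sqrt (u - s)))"
  using standard_bm unfolding standard_brownian_motion_def by blast

text \<open>Passes from independence of \<sigma>-algebras to random variables. The function
  \<open>h\<close> is there because the quadratic variation needs centred squares of
  increments.\<close>

lemma increment_indep_var:
  assumes "0 \<le> s" "s < u" and Y: "Y \<in> borel_measurable (F s)" and h: "h \<in> borel_measurable borel"
  shows "indep_var borel Y borel (\<lambda>\<omega>. h (B u \<omega> - B s \<omega>) :: real)"
proof -
  define X where "X \<omega> = B u \<omega> - B s \<omega>" for \<omega>
  let ?\<X> = "{X -` A \<inter> space M |A. A \<in> sets borel}"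
  have ind: "indep_set (sets (F s)) ?\<X>"
    using standard_bm assms unfolding standard_brownian_motion_def X_def by blast
  have X: "X \<in> borel_measurable M"
    unfolding X_def using assms
    by (intro borel_measurable_diff measurable_F_M[OF B_measurable_F[OF _ order_refl]]) auto
  have [measurable]: "Y \<in> borel_measurable M" "X \<in> borel_measurable M" "h \<in> borel_measurable borel"
    using measurable_F_M[OF Y] h X by auto
  \<comment> \<open>The preimages under X already form a \<sigma>-algebra, so the \<sigma>-algebra
    generated by any subfamily stays inside.\<close>
  have V: "sets (vimage_algebra (space M) X borel) = ?\<X>"
    by (rule sets_vimage_algebra2) auto
  have 1: "sigma_sets (space M) {Y -` A \<inter> space M |A. A \<in> sets borel} \<subseteq> sets (F s)"
    by (rule sets.sigma_sets_subset[of _ "F s", unfolded space_F])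
       (use measurable_sets[OF Y] in \<open>auto simp: space_F\<close>)
  have "(\<lambda>\<omega>. h (X \<omega>)) -` A \<inter> space M \<in> ?\<X>" if "A \<in> sets borel" for A
  proof -
    have "(\<lambda>\<omega>. h (X \<omega>)) -` A \<inter> space M = X -` (h -` A) \<inter> space M" by auto
    moreover have "h -` A \<in> sets borel" using measurable_sets[OF h that] by simp
    ultimately show ?thesis by blast
  qed
  then have "{(\<lambda>\<omega>. h (X \<omega>)) -` A \<inter> space M |A. A \<in> sets borel} \<subseteq> ?\<X>"
    by (subst Setcompr_eq_image) (rule image_subsetI)
  then have 2: "sigma_sets (space M) {(\<lambda>\<omega>. h (X \<omega>)) -` A \<inter> space M |A. A \<in> sets borel} \<subseteq> ?\<X>"
    unfolding V[symmetric]
    by (rule sets.sigma_sets_subset[of _ "vimage_algebra (space M) X borel", unfolded space_vimage_algebra])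
  have "indep_var borel Y borel (\<lambda>\<omega>. h (X \<omega>))"
    unfolding indep_var_eq
  proof (intro conjI)
    show "indep_set (sigma_sets (space M) {Y -` A \<inter> space M |A. A \<in> sets borel})
       (sigma_sets (space M) {(\<lambda>\<omega>. h (X \<omega>)) -` A \<inter> space M |A. A \<in> sets borel})"
      unfolding indep_set_def
    proof (rule indep_sets_mono_sets[OF ind[unfolded indep_set_def]])
      fix i :: bool
      show "case_bool (sigma_sets (space M) {Y -` A \<inter> space M |A. A \<in> sets borel})
         (sigma_sets (space M) {(\<lambda>\<omega>. h (X \<omega>)) -` A \<inter> space M |A. A \<in> sets borel}) i
        \<subseteq> case_bool (sets (F s)) ?\<X> i"
        using 1 2 by (cases i) (simp_all only: bool.case)
    qed
  qed measurable
  then show ?thesis by (simp add: X_def)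
qed

text \<open>Read off from the normal density; the fourth moment yields the variance of a squared
  increment.\<close>

lemma increment_moments:
  assumes "0 \<le> s" "s < u"
  shows "integrable M (\<lambda>\<omega>. (B u \<omega> - B s \<omega>) ^ k)"
    and "expectation (\<lambda>\<omega>. B u \<omega> - B s \<omega>) = 0"
    and "expectation (\<lambda>\<omega>. (B u \<omega> - B s \<omega>)\<^sup>2) = u - s"
    and "expectation (\<lambda>\<omega>. (B u \<omega> - B s \<omega>) ^ 4) = 3 * (u - s)\<^sup>2"
proof -
  note D = increment_distributed[OF assms]
  have sd: "0 < sqrt (u - s)" using assms by simp
  show "integrable M (\<lambda>\<omega>. (B u \<omega> - B s \<omega>) ^ k)"
    by (subst distributed_integrable[OF D, of "\<lambda>x. x ^ k", symmetric])
       (use integrable_normal_moment[OF sd, of 0 k] in \<open>auto simp: normal_density_nonneg\<close>)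
  have E: "expectation (\<lambda>\<omega>. (B u \<omega> - B s \<omega>) ^ k)
      = (\<integral>x. normal_density 0 (sqrt (u - s)) x * x ^ k \<partial>lborel)" for k
    by (subst distributed_integral[OF D]) (auto simp: normal_density_nonneg)
  show "expectation (\<lambda>\<omega>. B u \<omega> - B s \<omega>) = 0"
    using E[of 1] integral_normal_moment_odd[OF sd, of 0 0] by simp
  show "expectation (\<lambda>\<omega>. (B u \<omega> - B s \<omega>)\<^sup>2) = u - s"
    using E[of 2] integral_normal_moment_even[OF sd, of 0 1] assms by (simp add: fact_numeral)
  show "expectation (\<lambda>\<omega>. (B u \<omega> - B s \<omega>) ^ 4) = 3 * (u - s)\<^sup>2"
    using E[of 4] integral_normal_moment_even[OF sd, of 0 2] assms
    by (simp add: fact_numeral power_divide)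
qed

end

text \<open>Turns smallness in probability, which is how the Ito integral is defined, into smallness
  of a truncated mean, which can be added up over grid points.\<close>

lemma (in prob_space) expectation_min_one_le:
  assumes [measurable]: "X \<in> borel_measurable M" and "\<epsilon> \<ge> 0"
  shows "expectation (\<lambda>\<omega>. min 1 \<bar>X \<omega>\<bar> :: real) \<le> \<epsilon> + prob {\<omega> \<in> space M. \<bar>X \<omega>\<bar> > \<epsilon>}"
proof -
  let ?A = "{\<omega> \<in> space M. \<bar>X \<omega>\<bar> > \<epsilon>}"
  have "expectation (\<lambda>\<omega>. min 1 \<bar>X \<omega>\<bar>) \<le> expectation (\<lambda>\<omega>. \<epsilon> + indicator ?A \<omega>)"
  proof (rule integral_mono)
    show "integrable M (\<lambda>\<omega>. min 1 \<bar>X \<omega>\<bar>)"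
      by (rule integrable_const_bound[where B = 1]) auto
    show "integrable M (\<lambda>\<omega>. \<epsilon> + indicator ?A \<omega>)"
      by (intro Bochner_Integration.integrable_add integrable_const integrable_real_indicator)
         (auto simp: emeasure_eq_measure)
  qed (use \<open>\<epsilon> \<ge> 0\<close> in \<open>auto simp: indicator_def\<close>)
  also have "\<dots> = \<epsilon> + prob ?A"
    by (subst Bochner_Integration.integral_add) (auto simp: prob_space emeasure_eq_measure)
  finally show ?thesis .
qed

text \<open>Dominated convergence for the indicators.\<close>

lemma (in prob_space) prob_tendsto_zero:
  assumes [measurable]: "\<And>n. A n \<in> events" and "AE \<omega> in M. \<forall>\<^sub>F n in sequentially. \<omega> \<notin> A n"
  shows "(\<lambda>n. prob (A n)) \<longlonglongrightarrow> 0"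
proof -
  have "(\<lambda>n. expectation (indicator (A n) :: _ \<Rightarrow> real)) \<longlonglongrightarrow> expectation (\<lambda>\<omega>. 0)"
  proof (rule integral_dominated_convergence[where w = "\<lambda>_. 1"])
    show "AE \<omega> in M. (\<lambda>n. indicator (A n) \<omega> :: real) \<longlonglongrightarrow> 0"
      using assms(2)
    proof eventually_elim
      case (elim \<omega>)
      then have "\<forall>\<^sub>F n in sequentially. (indicator (A n) \<omega> :: real) = 0"
        by eventually_elim simp
      then show ?case by (rule tendsto_eventually)
    qed
  qed (auto simp: indicator_def)
  then show ?thesis by simp
qed

section \<open>Uniform grids and discrete stochastic integrals\<close>

definition grid :: "real \<Rightarrow> nat \<Rightarrow> nat \<Rightarrow> real" where
  "grid T N k = T * real k / real N"

lemma grid_0 [simp]: "grid T N 0 = 0"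
  by (simp add: grid_def)

lemma grid_end: "N > 0 \<Longrightarrow> grid T N N = T"
  by (simp add: grid_def)

lemma grid_Suc: "grid T N (Suc k) = grid T N k + T / N"
  by (simp add: grid_def distrib_left add_divide_distrib)

lemma grid_nonneg: "T \<ge> 0 \<Longrightarrow> grid T N k \<ge> 0"
  by (simp add: grid_def)

lemma grid_refine: "L > 0 \<Longrightarrow> grid T (N * L) (k * L) = grid T N k"
  by (simp add: grid_def)

lemma grid_mono: "T \<ge> 0 \<Longrightarrow> j \<le> k \<Longrightarrow> grid T N j \<le> grid T N k"
  by (simp add: grid_def divide_right_mono mult_left_mono)

lemma grid_le_end: "T \<ge> 0 \<Longrightarrow> N > 0 \<Longrightarrow> k \<le> N \<Longrightarrow> grid T N k \<le> T"
  using grid_mono[of T k N N] by (simp add: grid_end)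

lemma sum_block_shift:
  fixes f :: "nat \<Rightarrow> real"
  shows "(\<Sum>j = s..<s + n. f j) = (\<Sum>i<n. f (s + i))"
  using sum.shift_bounds_nat_ivl[of f 0 s n] by (simp add: add.commute atLeast0LessThan)

context brownian_motion
begin

abbreviation grid_increment :: "real \<Rightarrow> nat \<Rightarrow> nat \<Rightarrow> 'a \<Rightarrow> real" where
  "grid_increment T N j \<omega> \<equiv> B (grid T N (Suc j)) \<omega> - B (grid T N j) \<omega>"

lemma grid_increment_measurable:
  "T > 0 \<Longrightarrow> grid_increment T N j \<in> borel_measurable (F (grid T N (Suc j)))"
  by (intro borel_measurable_diff B_measurable_F grid_nonneg grid_mono) auto

text \<open>The start index \<open>s\<close> is free so that the bound serves the whole grid as well
  as a single block; it is linear in the number \<open>n\<close> of cells, so block bounds add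
  up.\<close>

lemma ito_sum_square_bound:
  assumes T: "T > 0" and N: "N > 0"
    and H: "\<And>j. H j \<in> borel_measurable (F (grid T N j))" and bound: "\<And>j \<omega>. \<bar>H j \<omega>\<bar> \<le> \<eta>"
  shows "integrable M (\<lambda>\<omega>. (\<Sum>j = s..<s + n. H j \<omega> * grid_increment T N j \<omega>)\<^sup>2)"
    and "expectation (\<lambda>\<omega>. (\<Sum>j = s..<s + n. H j \<omega> * grid_increment T N j \<omega>)\<^sup>2)
      \<le> n * (\<eta>\<^sup>2 * (T / N))"
proof -
  have grids: "0 \<le> grid T N j" "grid T N j < grid T N (Suc j)"
    "grid T N (Suc j) - grid T N j = T / N" for j
    using T N by (auto simp: grid_nonneg grid_Suc)
  note moments = increment_moments[OF grids(1,2), unfolded grids(3)]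
  have G_mono: "Y \<in> borel_measurable (F (grid T N (s + Suc i)))"
    if "Y \<in> borel_measurable (F (grid T N (s + i)))" for i and Y :: "'a \<Rightarrow> real"
    using measurable_F_mono[OF that] grids(2)[of "s + i"] by simp
  have X_meas: "grid_increment T N (s + i) \<in> borel_measurable (F (grid T N (s + Suc i)))" for i
    using grid_increment_measurable[OF T, of N "s + i"] by simp
  have ind: "indep_var borel Y borel (grid_increment T N (s + i))"
    if "Y \<in> borel_measurable (F (grid T N (s + i)))" for i Y
    using increment_indep_var[OF grids(1,2) that, of "\<lambda>x. x"] by simp
  have X_sq: "integrable M (\<lambda>\<omega>. (grid_increment T N (s + i) \<omega>)\<^sup>2)"
    and X_mean: "expectation (grid_increment T N (s + i)) = 0"
    and X_var: "expectation (\<lambda>\<omega>. (grid_increment T N (s + i) \<omega>)\<^sup>2) \<le> T / N" for i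
    using moments[of "s + i"] by simp_all
  note transform = martingale_transform_square_bound[where G = "\<lambda>i. F (grid T N (s + i))"
      and J = "\<lambda>i. H (s + i)" and X = "\<lambda>i. grid_increment T N (s + i)"]
  have "integrable M (\<lambda>\<omega>. (\<Sum>i<n. H (s + i) \<omega> * grid_increment T N (s + i) \<omega>)\<^sup>2)"
    by (rule transform(1)) (fact G_mono measurable_F_M H X_meas ind bound X_sq X_mean X_var)+
  moreover have "expectation (\<lambda>\<omega>. (\<Sum>i<n. H (s + i) \<omega> * grid_increment T N (s + i) \<omega>)\<^sup>2)
      \<le> n * (\<eta>\<^sup>2 * (T / N))"
    by (rule transform(2)) (fact G_mono measurable_F_M H X_meas ind bound X_sq X_mean X_var)+
  ultimately show "integrable M (\<lambda>\<omega>. (\<Sum>j = s..<s + n. H j \<omega> * grid_increment T N j \<omega>)\<^sup>2)"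
    "expectation (\<lambda>\<omega>. (\<Sum>j = s..<s + n. H j \<omega> * grid_increment T N j \<omega>)\<^sup>2) \<le> n * (\<eta>\<^sup>2 * (T / N))"
    by (simp_all add: sum_block_shift)
qed

text \<open>With h = T/N the centred squares are martingale differences of variance 3h^2 - 2h^2 +
  h^2 = 2h^2, and N of them give 2 T^2/N.\<close>

lemma quadratic_variation_square_bound:
  assumes T: "T > 0" and N: "N > 0"
  shows "integrable M (\<lambda>\<omega>. ((\<Sum>j<N. (grid_increment T N j \<omega>)\<^sup>2) - T)\<^sup>2)"
    and "expectation (\<lambda>\<omega>. ((\<Sum>j<N. (grid_increment T N j \<omega>)\<^sup>2) - T)\<^sup>2) \<le> 2 * T\<^sup>2 / N"
proof -
  have grids: "0 \<le> grid T N j" "grid T N j < grid T N (Suc j)"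
    "grid T N (Suc j) - grid T N j = T / N" for j
    using T N by (auto simp: grid_nonneg grid_Suc)
  note moments = increment_moments[OF grids(1,2), unfolded grids(3)]
  define X where "X j \<omega> = (grid_increment T N j \<omega>)\<^sup>2 - T / N" for j \<omega>
  have X_sq: "(X j \<omega>)\<^sup>2 = grid_increment T N j \<omega> ^ 4 - 2 * (T / N) * (grid_increment T N j \<omega>)\<^sup>2 + (T / N)\<^sup>2" for j \<omega>
  proof -
    have "(z\<^sup>2 - h)\<^sup>2 = z ^ 4 - 2 * h * z\<^sup>2 + h\<^sup>2" for z h :: real
      by (simp add: power2_eq_square power4_eq_xxxx algebra_simps)
    then show ?thesis unfolding X_def .
  qed
  have G_mono: "Y \<in> borel_measurable (F (grid T N (Suc i)))"
    if "Y \<in> borel_measurable (F (grid T N i))" for i and Y :: "'a \<Rightarrow> real"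
    using measurable_F_mono[OF that] grids(2)[of i] by simp
  have X_meas: "X i \<in> borel_measurable (F (grid T N (Suc i)))" for i
    unfolding X_def
    by (intro borel_measurable_diff borel_measurable_power grid_increment_measurable[OF T] borel_measurable_const)
  have ind: "indep_var borel Y borel (X i)"
    if "Y \<in> borel_measurable (F (grid T N i))" for i Y
    unfolding X_def using increment_indep_var[OF grids(1,2) that, of "\<lambda>x. x\<^sup>2 - T / N"] by simp
  have X_int: "integrable M (\<lambda>\<omega>. (X i \<omega>)\<^sup>2)" for i
    unfolding X_sq using moments(1)[of i] by auto
  have X_mean: "expectation (X i) = 0" for i
    unfolding X_def using moments(1)[of i 2] moments(3)[of i] by (simp add: prob_space)
  have "expectation (\<lambda>\<omega>. (X i \<omega>)\<^sup>2) = 3 * (T / N)\<^sup>2 - 2 * (T / N) * (T / N) + (T / N)\<^sup>2" for i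
    unfolding X_sq using moments(1)[of i 2] moments(1)[of i 4] moments(3,4)[of i]
    by (simp add: prob_space)
  then have X_var: "expectation (\<lambda>\<omega>. (X i \<omega>)\<^sup>2) \<le> 2 * (T / N)\<^sup>2" for i
    by (simp add: power2_eq_square)
  note transform = martingale_transform_square_bound[where G = "\<lambda>i. F (grid T N i)"
      and J = "\<lambda>_ _. 1" and X = X and \<eta> = 1]
  have "integrable M (\<lambda>\<omega>. (\<Sum>i<N. 1 * X i \<omega>)\<^sup>2)"
    by (rule transform(1)) (fact G_mono measurable_F_M X_meas ind X_int X_mean X_var | simp)+
  moreover have "expectation (\<lambda>\<omega>. (\<Sum>i<N. 1 * X i \<omega>)\<^sup>2) \<le> N * (1\<^sup>2 * (2 * (T / N)\<^sup>2))"
    by (rule transform(2)) (fact G_mono measurable_F_M X_meas ind X_int X_mean X_var | simp)+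
  moreover have "(\<Sum>i<N. 1 * X i \<omega>) = (\<Sum>j<N. (grid_increment T N j \<omega>)\<^sup>2) - T" for \<omega>
    using N by (simp add: X_def sum_subtractf)
  moreover have "N * (1\<^sup>2 * (2 * (T / N)\<^sup>2)) = 2 * T\<^sup>2 / N"
    using N by (simp add: power2_eq_square field_simps)
  ultimately show "integrable M (\<lambda>\<omega>. ((\<Sum>j<N. (grid_increment T N j \<omega>)\<^sup>2) - T)\<^sup>2)"
    "expectation (\<lambda>\<omega>. ((\<Sum>j<N. (grid_increment T N j \<omega>)\<^sup>2) - T)\<^sup>2) \<le> 2 * T\<^sup>2 / N"
    by simp_all
qed

text \<open>Each Ito integral comes with its own mesh threshold. There are only finitely many grid
  points, so the least threshold lets one refinement factor \<open>L\<close> serve all of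
  them.\<close>

lemma ito_grid_approximation:
  assumes ito: "\<And>k. k \<le> N \<Longrightarrow> has_ito_integral M F B H (grid T N k) (I k)"
    and T: "T > 0" and N: "N > 0" and \<epsilon>: "\<epsilon> > 0"
  shows "\<exists>L>0. \<forall>k\<le>N. expectation (\<lambda>\<omega>. min 1
    \<bar>(\<Sum>j<k * L. H (grid T (N * L) j) \<omega> * grid_increment T (N * L) j \<omega>) - I k \<omega>\<bar>) \<le> \<epsilon>"
proof -
  define ok where "ok k \<delta> \<longleftrightarrow> \<delta> > 0 \<and>
      (\<forall>n p. interval_partition (grid T N k) n p \<and> (\<forall>i<n. p (Suc i) - p i < \<delta>) \<longrightarrow>
      prob {\<omega> \<in> space M. \<bar>(\<Sum>i<n. H (p i) \<omega> * (B (p (Suc i)) \<omega> - B (p i) \<omega>)) - I k \<omega>\<bar> > \<epsilon> / 2} < \<epsilon> / 2)"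
    for k \<delta>
  have "\<exists>\<delta>. ok k \<delta>" if "k \<le> N" for k
    using ito[OF that] half_gt_zero[OF \<epsilon>] unfolding has_ito_integral_def ok_def by blast
  then obtain \<delta> where ok: "\<And>k. k \<le> N \<Longrightarrow> ok k (\<delta> k)"
    by metis
  then have \<delta>: "\<And>k. k \<le> N \<Longrightarrow> \<delta> k > 0" by (simp add: ok_def)
  define d where "d = Min (\<delta> ` {..N})"
  have d: "d > 0" "\<And>k. k \<le> N \<Longrightarrow> d \<le> \<delta> k"
    using \<delta> by (auto simp: d_def)
  obtain L :: nat where L: "real L > T / (N * d)" using reals_Archimedean2 by blast
  have "0 < T / (N * d)" using T N d by simp
  with L have L0: "L > 0" by (metis less_trans of_nat_0_less_iff)
  have mesh: "T / (N * L) < d"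
    using L N d L0 by (simp add: field_simps)
  have "expectation (\<lambda>\<omega>. min 1
    \<bar>(\<Sum>j<k * L. H (grid T (N * L) j) \<omega> * grid_increment T (N * L) j \<omega>) - I k \<omega>\<bar>) \<le> \<epsilon>"
    if k: "k \<le> N" for k
  proof -
    have [measurable]: "I k \<in> borel_measurable M"
      using ito[OF k] by (simp add: has_ito_integral_def)
    have [measurable]: "H (grid T (N * L) j) \<in> borel_measurable M" for j
      using ito[OF k] T measurable_F_M grid_nonneg
      unfolding has_ito_integral_def adapted_process_def by (meson less_imp_le)
    have [measurable]: "B (grid T (N * L) j) \<in> borel_measurable M" for j
      by (rule measurable_F_M[OF B_measurable_F[OF grid_nonneg order_refl]]) (use T in simp)
    let ?X = "\<lambda>\<omega>. (\<Sum>j<k * L. H (grid T (N * L) j) \<omega> * grid_increment T (N * L) j \<omega>) - I k \<omega>"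
    \<comment> \<open>The first \<open>k * L\<close> fine cells partition the interval up to the
      k-th coarse point. Half of \<epsilon> goes to the size of the error, half to its
      probability.\<close>
    have "prob {\<omega> \<in> space M. \<bar>?X \<omega>\<bar> > \<epsilon> / 2} < \<epsilon> / 2"
    proof (rule ok[OF k, unfolded ok_def, THEN conjunct2, rule_format], intro conjI allI impI)
      show "interval_partition (grid T N k) (k * L) (grid T (N * L))"
        using T L0 by (auto simp: interval_partition_def grid_refine intro: grid_mono)
      show "grid T (N * L) (Suc i) - grid T (N * L) i < \<delta> k" for i
        using mesh d(2)[OF k] by (simp add: grid_Suc)
    qed
    then show ?thesis
      using expectation_min_one_le[of ?X "\<epsilon> / 2"] \<epsilon> by simp
  qed
  then show ?thesis using L0 by blast
qed

end

subsection \<open>The price is a geometric Brownian motion\<close>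

lemma tendsto_min_one_zeroD:
  fixes x :: "nat \<Rightarrow> real"
  assumes "(\<lambda>n. min 1 (x n)) \<longlonglongrightarrow> 0"
  shows "x \<longlonglongrightarrow> 0"
proof (rule Lim_transform_eventually[OF assms])
  show "\<forall>\<^sub>F n in sequentially. min 1 (x n) = x n"
    using order_tendstoD(2)[OF assms zero_less_one] by eventually_elim linarith
qed

lemma sum_squares_le_square_sum_abs:
  fixes f :: "'b \<Rightarrow> real"
  shows "(\<Sum>i\<in>A. (f i)\<^sup>2) \<le> (\<Sum>i\<in>A. \<bar>f i\<bar>)\<^sup>2"
  using L2_set_le_sum_abs[of f A] unfolding L2_set_def
  by (rule sqrt_le_D)

text \<open>Stage n has \<open>Suc n\<close> coarse cells, each cut into \<open>L n\<close> fine
  ones. \<open>I s\<close> is an Ito integral up to time s, chosen for each s separately. The rate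
  in \<open>approx\<close> is quadratic so that the errors at all n + 2 coarse points together still
  tend to 0.\<close>

locale discretised_price = brownian_motion +
  fixes P :: "real \<Rightarrow> 'a \<Rightarrow> real" and \<sigma> T :: real and L :: "nat \<Rightarrow> nat"
    and I :: "real \<Rightarrow> 'a \<Rightarrow> real"
  assumes P_adapted: "adapted_process F P" and P_cont: "continuous_process M P"
    and P_pos: "AE \<omega> in M. \<forall>s\<ge>0. P s \<omega> > 0"
    and T: "T > 0" and L: "\<And>n. L n > 0"
    and I_measurable: "\<And>s. s \<ge> 0 \<Longrightarrow> I s \<in> borel_measurable M"
    and approx: "\<And>n k. k \<le> Suc n \<Longrightarrow> expectation (\<lambda>\<omega>. min 1
      \<bar>(\<Sum>j<k * L n. \<sigma> * P (grid T (Suc n * L n) j) \<omega> * grid_increment T (Suc n * L n) j \<omega>)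
        - I (grid T (Suc n) k) \<omega>\<bar>) \<le> 1 / (real n + 2)\<^sup>2"
begin

section \<open>Errors of the discretised price equation on coarse and fine grids\<close>

definition fine_size :: "nat \<Rightarrow> nat" where
  "fine_size n = Suc n * L n"

lemma fine_size_pos: "fine_size n > 0"
  using L by (simp add: fine_size_def)

text \<open>With \<open>rel_dev n\<close> as integrand, a block sum is the difference between the fine Ito
  sum of \<open>\<sigma> P dB\<close> over a coarse cell, divided by \<open>P\<close> at the left endpoint of the cell, and
  \<open>\<sigma>\<close> times the increment of \<open>B\<close> (see \<open>block_increment\<close>).\<close>

definition rel_dev :: "nat \<Rightarrow> nat \<Rightarrow> 'a \<Rightarrow> real" where
  "rel_dev n j \<omega> = \<sigma> * (P (grid T (fine_size n) j) \<omega> / P (grid T (Suc n) (j div L n)) \<omega> - 1)"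

definition block_sum :: "(nat \<Rightarrow> 'a \<Rightarrow> real) \<Rightarrow> nat \<Rightarrow> nat \<Rightarrow> 'a \<Rightarrow> real" where
  "block_sum H n k \<omega> = (\<Sum>j = k * L n..<k * L n + L n. H j \<omega> * grid_increment T (fine_size n) j \<omega>)"

definition fine_sum :: "nat \<Rightarrow> nat \<Rightarrow> 'a \<Rightarrow> real" where
  "fine_sum n k \<omega> = (\<Sum>j<k * L n. \<sigma> * P (grid T (fine_size n) j) \<omega> * grid_increment T (fine_size n) j \<omega>)"

definition clip :: "real \<Rightarrow> real \<Rightarrow> real" where
  "clip \<eta> x = max (- \<eta>) (min \<eta> x)"

text \<open>Outside this event, clipping at \<eta> changes no integrand of the stage.\<close>

definition bad :: "real \<Rightarrow> nat \<Rightarrow> 'a set" where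
  "bad \<eta> n = {\<omega> \<in> space M. \<exists>j<fine_size n. \<bar>rel_dev n j \<omega>\<bar> > \<eta>}"

lemma grid_T_nonneg: "grid T N k \<ge> 0"
  using T by (simp add: grid_nonneg)

lemma P_measurable_F: "P (grid T N k) \<in> borel_measurable (F (grid T N k))"
  using P_adapted grid_T_nonneg by (simp add: adapted_process_def)

lemma P_measurable [measurable]: "P (grid T N k) \<in> borel_measurable M"
  using measurable_F_M[OF P_measurable_F] .

lemma B_measurable [measurable]: "B (grid T N k) \<in> borel_measurable M"
  by (rule measurable_F_M[OF B_measurable_F[OF grid_T_nonneg order_refl]])

lemma I_grid_measurable [measurable]: "I (grid T N k) \<in> borel_measurable M"
  by (rule I_measurable[OF grid_T_nonneg])

lemma grid_coarse_fine: "grid T (Suc n) k = grid T (fine_size n) (k * L n)"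
  unfolding fine_size_def by (rule grid_refine[OF L, symmetric])

text \<open>Adapted, since the denominator is read at the left end of the coarse cell, which is no
  later than the fine point.\<close>

lemma rel_dev_measurable_F: "rel_dev n j \<in> borel_measurable (F (grid T (fine_size n) j))"
proof -
  have "grid T (Suc n) (j div L n) \<le> grid T (fine_size n) j"
    unfolding grid_coarse_fine using T by (intro grid_mono) auto
  then have "P (grid T (Suc n) (j div L n)) \<in> borel_measurable (F (grid T (fine_size n) j))"
    using measurable_F_mono[OF P_measurable_F] by blast
  then show ?thesis
    unfolding rel_dev_def using P_measurable_F[of "fine_size n" j] by simp
qed

lemma rel_dev_measurable [measurable]: "rel_dev n j \<in> borel_measurable M"
  using measurable_F_M[OF rel_dev_measurable_F] .

lemma clip_rel_dev_measurable_F: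
  "(\<lambda>\<omega>. clip \<eta> (rel_dev n j \<omega>)) \<in> borel_measurable (F (grid T (fine_size n) j))"
  unfolding clip_def using rel_dev_measurable_F by simp

lemma abs_clip_le: "\<eta> \<ge> 0 \<Longrightarrow> \<bar>clip \<eta> x\<bar> \<le> \<eta>"
  by (auto simp: clip_def)

lemma clip_eq: "\<bar>x\<bar> \<le> \<eta> \<Longrightarrow> clip \<eta> x = x"
  by (auto simp: clip_def)

lemma block_sum_measurable [measurable]:
  "(\<And>j. H j \<in> borel_measurable M) \<Longrightarrow> block_sum H n k \<in> borel_measurable M"
  unfolding block_sum_def by (intro borel_measurable_sum borel_measurable_times borel_measurable_diff B_measurable)

lemma fine_sum_measurable [measurable]: "fine_sum n k \<in> borel_measurable M"
  unfolding fine_sum_def by measurable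

lemma bad_event [measurable]: "bad \<eta> n \<in> events"
  unfolding bad_def by measurable

lemma sum_block_sum:
  "(\<Sum>k<Suc n. block_sum H n k \<omega>)
    = (\<Sum>j<fine_size n. H j \<omega> * grid_increment T (fine_size n) j \<omega>)"
  using sum.nat_group[of "\<lambda>j. H j \<omega> * grid_increment T (fine_size n) j \<omega>" "L n" "Suc n"]
  by (simp only: block_sum_def fine_size_def mult.commute[of "L n"])

text \<open>The sum over all blocks is a single Ito sum over the fine grid, costing \<eta>^2 T. Each
  block square costs \<eta>^2 T/(n+1), and there are n + 1 blocks.\<close>

lemma clipped_sums_bound:
  fixes n :: nat
  assumes "\<eta> \<ge> 0"
  defines "h \<equiv> block_sum (\<lambda>j \<omega>. clip \<eta> (rel_dev n j \<omega>)) n"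
  shows "integrable M (\<lambda>\<omega>. (\<Sum>k<Suc n. h k \<omega>)\<^sup>2 + (\<Sum>k<Suc n. (h k \<omega>)\<^sup>2))"
    and "expectation (\<lambda>\<omega>. (\<Sum>k<Suc n. h k \<omega>)\<^sup>2 + (\<Sum>k<Suc n. (h k \<omega>)\<^sup>2)) \<le> 2 * (\<eta>\<^sup>2 * T)"
proof -
  note bound = ito_sum_square_bound[OF T fine_size_pos[of n] clip_rel_dev_measurable_F abs_clip_le[OF \<open>\<eta> \<ge> 0\<close>]]
  have 1: "integrable M (\<lambda>\<omega>. (\<Sum>k<Suc n. h k \<omega>)\<^sup>2)"
    "expectation (\<lambda>\<omega>. (\<Sum>k<Suc n. h k \<omega>)\<^sup>2) \<le> \<eta>\<^sup>2 * T"
    unfolding h_def sum_block_sum using bound[of 0 "fine_size n"] fine_size_pos[of n]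
    by (simp_all add: atLeast0LessThan)
  have 2: "integrable M (\<lambda>\<omega>. (h k \<omega>)\<^sup>2)"
    "expectation (\<lambda>\<omega>. (h k \<omega>)\<^sup>2) \<le> L n * (\<eta>\<^sup>2 * (T / (fine_size n)))" for k
    unfolding h_def block_sum_def by (rule bound)+
  have "expectation (\<lambda>\<omega>. \<Sum>k<Suc n. (h k \<omega>)\<^sup>2) = (\<Sum>k<Suc n. expectation (\<lambda>\<omega>. (h k \<omega>)\<^sup>2))"
    using 2(1) by (intro Bochner_Integration.integral_sum) auto
  also have "\<dots> \<le> (\<Sum>k<Suc n. L n * (\<eta>\<^sup>2 * (T / (fine_size n))))"
    by (intro sum_mono 2)
  also have "\<dots> = \<eta>\<^sup>2 * T" using L[of n]
    by (simp add: fine_size_def del: of_nat_Suc mult_Suc sum.lessThan_Suc)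
  finally have 3: "expectation (\<lambda>\<omega>. \<Sum>k<Suc n. (h k \<omega>)\<^sup>2) \<le> \<eta>\<^sup>2 * T" .
  have 4: "integrable M (\<lambda>\<omega>. \<Sum>k<Suc n. (h k \<omega>)\<^sup>2)"
    using 2(1) by (intro Bochner_Integration.integrable_sum) auto
  show "integrable M (\<lambda>\<omega>. (\<Sum>k<Suc n. h k \<omega>)\<^sup>2 + (\<Sum>k<Suc n. (h k \<omega>)\<^sup>2))"
    by (intro Bochner_Integration.integrable_add 1 4)
  show "expectation (\<lambda>\<omega>. (\<Sum>k<Suc n. h k \<omega>)\<^sup>2 + (\<Sum>k<Suc n. (h k \<omega>)\<^sup>2)) \<le> 2 * (\<eta>\<^sup>2 * T)"
    using 1 3 4 by (subst Bochner_Integration.integral_add) auto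
qed

text \<open>A fine point lies within T/(n+1) of the left end of its coarse cell, so along almost
  every path uniform continuity excludes the event from some stage on.\<close>

lemma prob_bad:
  assumes "\<eta> > 0"
  shows "(\<lambda>n. prob (bad \<eta> n)) \<longlonglongrightarrow> 0"
proof (rule prob_tendsto_zero)
  show "AE \<omega> in M. \<forall>\<^sub>F n in sequentially. \<omega> \<notin> bad \<eta> n"
    using P_pos P_cont[unfolded continuous_process_def]
  proof eventually_elim
    case (elim \<omega>)
    \<comment> \<open>Dividing by |\<sigma>| + 1, which is always positive, absorbs the factor
      \<sigma> in \<open>rel_dev\<close>.\<close>
    have \<eta>': "\<eta> / (\<bar>\<sigma>\<bar> + 1) > 0" using assms by (simp add: add_nonneg_pos)
    have "continuous_on {0..T} (\<lambda>s. P s \<omega>)"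
      using elim(2) by (rule continuous_on_subset) auto
    then obtain \<delta> where \<delta>: "\<delta> > 0" "\<forall>s\<in>{0..T}. \<forall>u\<in>{0..T}. \<bar>s - u\<bar> < \<delta> \<longrightarrow>
        \<bar>P s \<omega> / P u \<omega> - 1\<bar> \<le> \<eta> / (\<bar>\<sigma>\<bar> + 1)"
      using continuous_on_interval_ratio_close[OF _ _ _ \<eta>', of T "\<lambda>s. P s \<omega>"] elim(1) T by auto
    have "(\<lambda>n. T / real (Suc n)) \<longlonglongrightarrow> 0"
      by (intro real_tendsto_divide_at_top[OF tendsto_const] filterlim_compose[OF filterlim_real_sequentially] filterlim_Suc)
    then have "\<forall>\<^sub>F n in sequentially. T / real (Suc n) < \<delta>"
      using order_tendstoD(2) \<delta>(1) by blast
    then show ?case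
    proof eventually_elim
      case (elim n)
      have "\<bar>rel_dev n j \<omega>\<bar> \<le> \<eta>" if j: "j < fine_size n" for j
      proof -
        let ?s = "grid T (fine_size n) j" and ?u = "grid T (Suc n) (j div L n)"
        have "real j = real (j div L n * L n) + real (j mod L n)"
          by (simp only: of_nat_add[symmetric] div_mult_mod_eq)
        then have "?s - ?u = T * real (j mod L n) / real (fine_size n)"
          unfolding grid_coarse_fine unfolding grid_def
          by (simp only: distrib_left add_divide_distrib add_diff_cancel_left')
        moreover have "T * real (j mod L n) / real (fine_size n) \<le> T * real (L n) / real (fine_size n)"
          using T L[of n] by (intro divide_right_mono mult_left_mono) (auto simp: less_imp_le)
        moreover have "T * real (L n) / real (fine_size n) = T / real (Suc n)"
          using L[of n] by (simp add: fine_size_def del: of_nat_Suc mult_Suc)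
        moreover have "T * real (j mod L n) / real (fine_size n) \<ge> 0" using T by simp
        ultimately have close: "\<bar>?s - ?u\<bar> < \<delta>" using elim by linarith
        have "j div L n < Suc n" using j by (simp add: fine_size_def less_mult_imp_div_less del: mult_Suc)
        then have "?s \<in> {0..T}" "?u \<in> {0..T}"
          using j T fine_size_pos[of n] by (auto intro!: grid_T_nonneg grid_le_end)
        then have "\<bar>P ?s \<omega> / P ?u \<omega> - 1\<bar> \<le> \<eta> / (\<bar>\<sigma>\<bar> + 1)" using \<delta>(2) close by blast
        then have "\<bar>rel_dev n j \<omega>\<bar> \<le> \<bar>\<sigma>\<bar> * (\<eta> / (\<bar>\<sigma>\<bar> + 1))"
          unfolding rel_dev_def abs_mult by (intro mult_left_mono) auto
        also have "\<dots> \<le> (\<bar>\<sigma>\<bar> + 1) * (\<eta> / (\<bar>\<sigma>\<bar> + 1))" using \<eta>' by (intro mult_right_mono) auto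
        also have "\<dots> = \<eta>" by (simp add: add_nonneg_pos order_less_imp_not_eq2)
        finally show ?thesis .
      qed
      then show ?case by (force simp: bad_def)
    qed
  qed
qed measurable

text \<open>The price need not be integrable, so the errors are cut off at \<open>1\<close>: their expectations
  control convergence in probability.\<close>

definition total_error :: "nat \<Rightarrow> 'a \<Rightarrow> real" where
  "total_error n \<omega> = min 1 ((\<Sum>k<Suc n. block_sum (rel_dev n) n k \<omega>)\<^sup>2 + (\<Sum>k<Suc n. (block_sum (rel_dev n) n k \<omega>)\<^sup>2))
    + (((\<Sum>k<Suc n. (grid_increment T (Suc n) k \<omega>)\<^sup>2) - T)\<^sup>2
      + (\<Sum>k\<le>Suc n. min 1 \<bar>fine_sum n k \<omega> - I (grid T (Suc n) k) \<omega>\<bar>))"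

text \<open>The truncated part is at most 1 on \<open>bad\<close> and equals its clipped version or
  less elsewhere; the other two parts are the quadratic variation error and the Ito approximation
  errors.\<close>

lemma total_error_bound:
  assumes "\<eta> > 0"
  shows "integrable M (total_error n)"
    and "expectation (total_error n) \<le> prob (bad \<eta> n) + 2 * (\<eta>\<^sup>2 * T) + (2 * T\<^sup>2 / Suc n + 1 / (real n + 2))"
proof -
  define h where "h = block_sum (\<lambda>j \<omega>. clip \<eta> (rel_dev n j \<omega>)) n"
  define W where "W H \<omega> = (\<Sum>k<Suc n. block_sum H n k \<omega>)\<^sup>2 + (\<Sum>k<Suc n. (block_sum H n k \<omega>)\<^sup>2)" for H \<omega>
  define R where "R k \<omega> = min 1 \<bar>fine_sum n k \<omega> - I (grid T (Suc n) k) \<omega>\<bar>" for k \<omega>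
  define Q where "Q \<omega> = ((\<Sum>k<Suc n. (grid_increment T (Suc n) k \<omega>)\<^sup>2) - T)\<^sup>2" for \<omega>
  have total_error_eq: "total_error n = (\<lambda>\<omega>. min 1 (W (rel_dev n) \<omega>) + (Q \<omega> + (\<Sum>k\<le>Suc n. R k \<omega>)))"
    by (auto simp: total_error_def W_def Q_def R_def)
  have W_nonneg: "W H \<omega> \<ge> 0" for H \<omega> by (auto simp: W_def intro!: add_nonneg_nonneg sum_nonneg)
  have W_meas: "W (rel_dev n) \<in> borel_measurable M" unfolding W_def by measurable
  have W_int: "integrable M (\<lambda>\<omega>. min 1 (W (rel_dev n) \<omega>))"
    by (rule integrable_const_bound[where B = 1]) (use W_nonneg W_meas in auto)
  note c = clipped_sums_bound[OF less_imp_le[OF assms], of n, folded W_def]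
  have "expectation (\<lambda>\<omega>. min 1 (W (rel_dev n) \<omega>))
      \<le> expectation (\<lambda>\<omega>. indicator (bad \<eta> n) \<omega> + W (\<lambda>j \<omega>. clip \<eta> (rel_dev n j \<omega>)) \<omega>)"
  proof (rule integral_mono)
    show "integrable M (\<lambda>\<omega>. indicator (bad \<eta> n) \<omega> + W (\<lambda>j \<omega>. clip \<eta> (rel_dev n j \<omega>)) \<omega>)"
      by (intro Bochner_Integration.integrable_add c integrable_real_indicator) (auto simp: emeasure_eq_measure)
    fix \<omega> assume \<omega>: "\<omega> \<in> space M"
    show "min 1 (W (rel_dev n) \<omega>) \<le> indicator (bad \<eta> n) \<omega> + W (\<lambda>j \<omega>. clip \<eta> (rel_dev n j \<omega>)) \<omega>"
    proof (cases "\<omega> \<in> bad \<eta> n")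
      case True
      then show ?thesis using W_nonneg[of "\<lambda>j \<omega>. clip \<eta> (rel_dev n j \<omega>)" \<omega>] by simp
    next
      case False
      then have rel_dev: "clip \<eta> (rel_dev n j \<omega>) = rel_dev n j \<omega>" if "j < fine_size n" for j
        using that \<omega> by (intro clip_eq) (force simp: bad_def)
      have "block_sum (\<lambda>j \<omega>. clip \<eta> (rel_dev n j \<omega>)) n k \<omega> = block_sum (rel_dev n) n k \<omega>" if "k < Suc n" for k
      proof -
        have "k * L n + L n \<le> fine_size n"
          using mult_le_mono1[of "Suc k" "Suc n" "L n"] that by (simp add: fine_size_def)
        then show ?thesis unfolding block_sum_def using rel_dev by (intro sum.cong) (auto)
      qed
      then have "W (\<lambda>j \<omega>. clip \<eta> (rel_dev n j \<omega>)) \<omega> = W (rel_dev n) \<omega>"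
        by (simp add: W_def del: sum.lessThan_Suc)
      then show ?thesis using False by simp
    qed
  qed (fact W_int)
  also have "\<dots> \<le> prob (bad \<eta> n) + 2 * (\<eta>\<^sup>2 * T)"
    using c by (subst Bochner_Integration.integral_add) (auto simp: emeasure_eq_measure)
  finally have 1: "expectation (\<lambda>\<omega>. min 1 (W (rel_dev n) \<omega>)) \<le> prob (bad \<eta> n) + 2 * (\<eta>\<^sup>2 * T)" .
  have 2: "integrable M Q" "expectation Q \<le> 2 * T\<^sup>2 / Suc n"
    unfolding Q_def using quadratic_variation_square_bound[OF T, of "Suc n"] by auto
  have R_int: "integrable M (R k)" for k
    unfolding R_def by (rule integrable_const_bound[where B = 1]) auto
  then have R_sum: "integrable M (\<lambda>\<omega>. \<Sum>k\<le>Suc n. R k \<omega>)"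
    by (intro Bochner_Integration.integrable_sum)
  have "expectation (\<lambda>\<omega>. \<Sum>k\<le>Suc n. R k \<omega>) = (\<Sum>k\<le>Suc n. expectation (R k))"
    using R_int by (intro Bochner_Integration.integral_sum)
  also have "\<dots> \<le> (\<Sum>k\<le>Suc n. 1 / (real n + 2)\<^sup>2)"
    using approx unfolding R_def fine_sum_def fine_size_def by (intro sum_mono) auto
  \<comment> \<open>The index k runs over n + 2 coarse points, both ends included, which cancels one
    power.\<close>
  also have "\<dots> = 1 / (real n + 2)"
  proof -
    have "(\<Sum>k\<le>Suc n. 1 / (real n + 2)\<^sup>2) = (real n + 2) * (1 / (real n + 2)\<^sup>2)"
      by (simp only: sum_constant card_atMost) simp
    then show ?thesis by (simp add: power2_eq_square)
  qed
  finally have 3: "expectation (\<lambda>\<omega>. \<Sum>k\<le>Suc n. R k \<omega>) \<le> 1 / (real n + 2)" .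
  show "integrable M (total_error n)" unfolding total_error_eq
    by (intro Bochner_Integration.integrable_add W_int 2 R_sum)
  have "expectation (total_error n) = expectation (\<lambda>\<omega>. min 1 (W (rel_dev n) \<omega>))
      + (expectation Q + expectation (\<lambda>\<omega>. \<Sum>k\<le>Suc n. R k \<omega>))"
    unfolding total_error_eq
    by (subst Bochner_Integration.integral_add, (intro Bochner_Integration.integrable_add W_int 2 R_sum)+,
        subst Bochner_Integration.integral_add, (intro 2 R_sum)+) (rule refl)
  then show "expectation (total_error n) \<le> prob (bad \<eta> n) + 2 * (\<eta>\<^sup>2 * T) + (2 * T\<^sup>2 / Suc n + 1 / (real n + 2))"
    using 1 2 3 by linarith
qed

lemma total_error_nonneg: "total_error n \<omega> \<ge> 0"
  by (auto simp: total_error_def simp del: sum.lessThan_Suc sum.atMost_Suc intro!: add_nonneg_nonneg sum_nonneg)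

lemma expectation_total_error: "(\<lambda>n. expectation (total_error n)) \<longlonglongrightarrow> 0"
proof (rule LIMSEQ_I)
  fix e :: real assume e: "e > 0"
  \<comment> \<open>Solves \<open>2 * (\<eta>\<^sup>2 * T) = e / 2\<close>. With \<eta> fixed, the
    remaining terms vanish as n grows.\<close>
  define \<eta> where "\<eta> = sqrt (e / (4 * T))"
  have \<eta>: "\<eta> > 0" "2 * (\<eta>\<^sup>2 * T) = e / 2" using e T by (auto simp: \<eta>_def)
  have "(\<lambda>n. prob (bad \<eta> n) + 2 * (\<eta>\<^sup>2 * T) + (2 * T\<^sup>2 / Suc n + 1 / (real n + 2)))
      \<longlonglongrightarrow> 0 + 2 * (\<eta>\<^sup>2 * T) + (0 + 0)"
    by (intro tendsto_add tendsto_const prob_bad \<eta>(1)) real_asymp+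
  then have "\<forall>\<^sub>F n in sequentially.
      prob (bad \<eta> n) + 2 * (\<eta>\<^sup>2 * T) + (2 * T\<^sup>2 / Suc n + 1 / (real n + 2)) < e"
    by (rule order_tendstoD(2)) (use \<eta>(2) e in simp)
  then have "\<forall>\<^sub>F n in sequentially. norm (expectation (total_error n) - 0) < e"
  proof eventually_elim
    case (elim n)
    have "expectation (total_error n) \<ge> 0" by (intro integral_nonneg_AE AE_I2 total_error_nonneg)
    then show ?case using total_error_bound(2)[OF \<eta>(1), of n] elim by simp
  qed
  then show "\<exists>no. \<forall>n\<ge>no. norm (expectation (total_error n) - 0) < e"
    by (simp add: eventually_sequentially)
qed

text \<open>Convergence in mean gives almost sure convergence along a subsequence. All errors are
  bundled into one quantity so that a single subsequence serves them all.\<close>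

lemma total_error_subseq: "\<exists>r. strict_mono r \<and> (AE \<omega> in M. (\<lambda>n. total_error (r n) \<omega>) \<longlonglongrightarrow> 0)"
proof (rule tendsto_L1_AE_subseq)
  show "integrable M (total_error n)" for n using total_error_bound(1)[OF zero_less_one] .
  show "(\<lambda>n. expectation (\<lambda>\<omega>. norm (total_error n \<omega>))) \<longlonglongrightarrow> 0"
    using expectation_total_error total_error_nonneg by simp
qed

text \<open>Multiplying \<open>rel_dev + \<sigma>\<close> by the price at the coarse left endpoint
  restores \<sigma> P at the fine point, while the Brownian increments within the block
  telescope.\<close>

lemma block_increment:
  assumes "P (grid T (Suc n) k) \<omega> \<noteq> 0"
  shows "P (grid T (Suc n) k) \<omega> * (block_sum (rel_dev n) n k \<omega> + \<sigma> * grid_increment T (Suc n) k \<omega>)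
    = fine_sum n (Suc k) \<omega> - fine_sum n k \<omega>"
proof -
  let ?p = "P (grid T (Suc n) k) \<omega>" and ?\<Delta> = "\<lambda>j. grid_increment T (fine_size n) j \<omega>"
  let ?K = "{k * L n..<k * L n + L n}"
  have "(\<Sum>j\<in>?K. ?\<Delta> j) = B (grid T (fine_size n) (k * L n + L n)) \<omega> - B (grid T (fine_size n) (k * L n)) \<omega>"
    by (rule sum_Suc_diff') simp
  also have "\<dots> = grid_increment T (Suc n) k \<omega>"
    unfolding grid_coarse_fine by (simp add: add.commute)
  finally have inc: "grid_increment T (Suc n) k \<omega> = (\<Sum>j\<in>?K. ?\<Delta> j)" by simp
  have "?p * (block_sum (rel_dev n) n k \<omega> + \<sigma> * grid_increment T (Suc n) k \<omega>)
      = (\<Sum>j\<in>?K. ?p * (rel_dev n j \<omega> + \<sigma>) * ?\<Delta> j)"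
    unfolding inc block_sum_def sum_distrib_left sum.distrib[symmetric]
    by (intro sum.cong refl) (simp add: algebra_simps)
  also have "\<dots> = (\<Sum>j\<in>?K. \<sigma> * P (grid T (fine_size n) j) \<omega> * ?\<Delta> j)"
  proof (rule sum.cong)
    fix j assume "j \<in> ?K"
    then have "j div L n = k" by (intro div_nat_eqI) (auto simp: algebra_simps)
    then show "?p * (rel_dev n j \<omega> + \<sigma>) * ?\<Delta> j = \<sigma> * P (grid T (fine_size n) j) \<omega> * ?\<Delta> j"
      using assms by (simp add: rel_dev_def field_simps)
  qed simp
  also have "\<dots> = fine_sum n (Suc k) \<omega> - fine_sum n k \<omega>"
  proof -
    have "{..<Suc k * L n} = {..<k * L n} \<union> ?K" by auto
    then have "fine_sum n (Suc k) \<omega> = fine_sum n k \<omega> + (\<Sum>j\<in>?K. \<sigma> * P (grid T (fine_size n) j) \<omega> * ?\<Delta> j)"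
      unfolding fine_sum_def fine_size_def[symmetric] by (simp add: sum.union_disjoint ivl_disj_int)
    then show ?thesis by simp
  qed
  finally show ?thesis .
qed

text \<open>All summands are nonnegative, so each is squeezed to 0; the truncations are eventually
  inactive.\<close>

lemma total_error_tendsto_zeroD:
  assumes "(\<lambda>n. total_error (r n) \<omega>) \<longlonglongrightarrow> 0"
  shows "(\<lambda>n. \<Sum>k<Suc (r n). block_sum (rel_dev (r n)) (r n) k \<omega>) \<longlonglongrightarrow> 0"
    and "(\<lambda>n. \<Sum>k<Suc (r n). (block_sum (rel_dev (r n)) (r n) k \<omega>)\<^sup>2) \<longlonglongrightarrow> 0"
    and "(\<lambda>n. \<Sum>k<Suc (r n). (grid_increment T (Suc (r n)) k \<omega>)\<^sup>2) \<longlonglongrightarrow> T"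
    and "(\<lambda>n. \<Sum>k\<le>Suc (r n). \<bar>fine_sum (r n) k \<omega> - I (grid T (Suc (r n)) k) \<omega>\<bar>) \<longlonglongrightarrow> 0"
proof -
  define a where "a n = (\<Sum>k<Suc n. block_sum (rel_dev n) n k \<omega>)\<^sup>2" for n
  define b where "b n = (\<Sum>k<Suc n. (block_sum (rel_dev n) n k \<omega>)\<^sup>2)" for n
  define c where "c n = ((\<Sum>k<Suc n. (grid_increment T (Suc n) k \<omega>)\<^sup>2) - T)\<^sup>2" for n
  define x where "x n k = \<bar>fine_sum n k \<omega> - I (grid T (Suc n) k) \<omega>\<bar>" for n k
  have total_error_eq: "total_error n \<omega> = min 1 (a n + b n) + (c n + (\<Sum>k\<le>Suc n. min 1 (x n k)))" for n
    by (simp only: total_error_def a_def b_def c_def x_def)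
  have nonneg: "a n \<ge> 0" "b n \<ge> 0" "c n \<ge> 0" "x n k \<ge> 0" for n k
    by (auto simp: a_def b_def c_def x_def simp del: sum.lessThan_Suc intro!: sum_nonneg)
  have X_nonneg: "(\<Sum>k\<le>Suc n. min 1 (x n k)) \<ge> 0" for n
    using nonneg by (intro sum_nonneg) auto
  have to0: "y \<longlonglongrightarrow> 0" if "\<And>n. 0 \<le> y n" "\<And>n. y n \<le> total_error (r n) \<omega>" for y
    by (rule tendsto_sandwich[OF _ _ tendsto_const assms]) (use that in auto)
  have "(\<lambda>n. min 1 (a (r n) + b (r n))) \<longlonglongrightarrow> 0"
  proof (rule to0)
    fix n
    show "0 \<le> min 1 (a (r n) + b (r n))" using nonneg(1,2)[of "r n"] by simp
    show "min 1 (a (r n) + b (r n)) \<le> total_error (r n) \<omega>"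
      unfolding total_error_eq using nonneg(3)[of "r n"] X_nonneg[of "r n"] by linarith
  qed
  then have ab: "(\<lambda>n. a (r n) + b (r n)) \<longlonglongrightarrow> 0" by (rule tendsto_min_one_zeroD)
  have a: "(\<lambda>n. a (r n)) \<longlonglongrightarrow> 0" and b: "(\<lambda>n. b (r n)) \<longlonglongrightarrow> 0"
    by (rule tendsto_sandwich[OF _ _ tendsto_const ab]; use nonneg in simp)+
  have min_nonneg: "0 \<le> min 1 (a n + b n)" for n using nonneg(1,2)[of n] by simp
  have c: "(\<lambda>n. c (r n)) \<longlonglongrightarrow> 0"
  proof (rule to0)
    show "c (r n) \<le> total_error (r n) \<omega>" for n
      unfolding total_error_eq using min_nonneg[of "r n"] X_nonneg[of "r n"] by linarith
  qed (rule nonneg)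
  show "(\<lambda>n. \<Sum>k<Suc (r n). block_sum (rel_dev (r n)) (r n) k \<omega>) \<longlonglongrightarrow> 0"
    using a by (simp add: a_def del: sum.lessThan_Suc)
  show "(\<lambda>n. \<Sum>k<Suc (r n). (block_sum (rel_dev (r n)) (r n) k \<omega>)\<^sup>2) \<longlonglongrightarrow> 0"
    using b by (simp only: b_def)
  have "(\<lambda>n. (\<Sum>k<Suc (r n). (grid_increment T (Suc (r n)) k \<omega>)\<^sup>2) - T) \<longlonglongrightarrow> 0"
    using c by (simp add: c_def del: sum.lessThan_Suc)
  then show "(\<lambda>n. \<Sum>k<Suc (r n). (grid_increment T (Suc (r n)) k \<omega>)\<^sup>2) \<longlonglongrightarrow> T"
    by (simp only: LIM_zero_iff)
  have "(\<lambda>n. \<Sum>k\<le>Suc (r n). min 1 (x (r n) k)) \<longlonglongrightarrow> 0"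
  proof (rule to0)
    show "(\<Sum>k\<le>Suc (r n). min 1 (x (r n) k)) \<le> total_error (r n) \<omega>" for n
      unfolding total_error_eq using min_nonneg[of "r n"] nonneg(3)[of "r n"] by linarith
  qed (rule X_nonneg)
  \<comment> \<open>A sum of nonnegative terms below 1 forces each term below 1, so none is
    truncated.\<close>
  moreover have "\<forall>\<^sub>F n in sequentially. (\<Sum>k\<le>Suc (r n). min 1 (x (r n) k)) = (\<Sum>k\<le>Suc (r n). x (r n) k)"
    using order_tendstoD(2)[OF calculation zero_less_one]
  proof eventually_elim
    case (elim n)
    have "min 1 (x (r n) k) < 1" if "k \<in> {..Suc (r n)}" for k
      using member_le_sum[OF that, of "\<lambda>k. min 1 (x (r n) k)"] nonneg elim by fastforce
    then have "min 1 (x (r n) k) = x (r n) k" if "k \<in> {..Suc (r n)}" for k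
      using that by fastforce
    then show ?case by (rule sum.cong[OF refl])
  qed
  ultimately have "(\<lambda>n. \<Sum>k\<le>Suc (r n). x (r n) k) \<longlonglongrightarrow> 0"
    by (rule Lim_transform_eventually)
  then show "(\<lambda>n. \<Sum>k\<le>Suc (r n). \<bar>fine_sum (r n) k \<omega> - I (grid T (Suc (r n)) k) \<omega>\<bar>) \<longlonglongrightarrow> 0"
    by (simp only: x_def)
qed

text \<open>Along the subsequence, almost every path satisfies the hypotheses of
  \<open>log_path_limit\<close>. The true cell errors \<open>e\<close> are compared with the block
  sums \<open>\<phi>\<close>, whose limits are known.\<close>

lemma log_price:
  assumes SDE: "\<And>s. s \<ge> 0 \<Longrightarrow> AE \<omega> in M. P s \<omega> = P 0 \<omega> + integral {0..s} (\<lambda>u. g * P u \<omega>) + I s \<omega>"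
  shows "AE \<omega> in M. ln (P T \<omega>) - ln (P 0 \<omega>) = (g - \<sigma>\<^sup>2 / 2) * T + \<sigma> * (B T \<omega> - B 0 \<omega>)"
proof -
  obtain r where r: "strict_mono r" and V0: "AE \<omega> in M. (\<lambda>n. total_error (r n) \<omega>) \<longlonglongrightarrow> 0"
    using total_error_subseq by blast
  \<comment> \<open>The price equation holds almost surely at each time separately; only countably
    many grid times occur, so one null set suffices.\<close>
  have grid_SDE: "AE \<omega> in M. \<forall>n k. P (grid T n k) \<omega>
      = P 0 \<omega> + integral {0..grid T n k} (\<lambda>u. g * P u \<omega>) + I (grid T n k) \<omega>"
    unfolding AE_all_countable using SDE[OF grid_T_nonneg] by blast
  show ?thesis
    using V0 grid_SDE P_pos P_cont[unfolded continuous_process_def]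
  proof eventually_elim
    case (elim \<omega>)
    define p where "p s = P s \<omega>" for s
    define N where "N n = Suc (r n)" for n
    have cont0: "continuous_on {0..} p" using elim(4) by (simp add: p_def)
    then have cont: "continuous_on {0..T} p" by (rule continuous_on_subset) auto
    have pos: "p s > 0" if "s \<ge> 0" for s using elim(3) that by (simp add: p_def)
    obtain c where c: "c > 0" "\<And>s. s \<in> {0..T} \<Longrightarrow> p s \<ge> c"
      using continuous_on_interval_positive_lower_bound[OF cont] pos T by auto
    define \<phi> where "\<phi> n k = block_sum (rel_dev (r n)) (r n) k \<omega>" for n k
    define x where "x n k = fine_sum (r n) k \<omega> - I (grid T (N n) k) \<omega>" for n k
    \<comment> \<open>The residual that makes the cell equation exact with \<sigma> P frozen at the
      left endpoint. Replacing the Ito integrals by fine sums would turn it into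
      \<open>\<phi>\<close>.\<close>
    define e where "e n k = (I (grid T (N n) (Suc k)) \<omega> - I (grid T (N n) k) \<omega>) / p (grid T (N n) k)
        - \<sigma> * (B (grid T (N n) (Suc k)) \<omega> - B (grid T (N n) k) \<omega>)" for n k
    note limits = total_error_tendsto_zeroD[OF elim(1), folded N_def \<phi>_def x_def]
    have p_grid: "p (grid T (N n) k) \<ge> c" if "k < N n" for n k
      using that T by (intro c(2)) (auto simp: N_def intro!: grid_T_nonneg grid_le_end)
    have e_diff: "e n k - \<phi> n k = (x n k - x n (Suc k)) / p (grid T (N n) k)" for n k
    proof -
      have "p (grid T (N n) k) > 0" using pos grid_T_nonneg by blast
      then show ?thesis
        using block_increment[of "r n" k \<omega>, folded N_def \<phi>_def p_def]
        by (simp add: e_def x_def field_simps)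
    qed
    \<comment> \<open>Every approximation error \<open>x\<close> enters at most two cells, and the
      price is at least c, whence 2/c.\<close>
    have sum_e_diff: "(\<Sum>k<N n. \<bar>e n k - \<phi> n k\<bar>) \<le> 2 / c * (\<Sum>k\<le>N n. \<bar>x n k\<bar>)" for n
    proof -
      have "(\<Sum>k<N n. \<bar>e n k - \<phi> n k\<bar>) \<le> (\<Sum>k<N n. (\<bar>x n k\<bar> + \<bar>x n (Suc k)\<bar>) / c)"
        unfolding e_diff abs_divide using c(1) p_grid
        by (intro sum_mono frac_le) (auto intro: order_trans[OF _ abs_ge_self])
      also have "\<dots> = ((\<Sum>k<N n. \<bar>x n k\<bar>) + (\<Sum>k<N n. \<bar>x n (Suc k)\<bar>)) / c"
        by (simp add: sum.distrib sum_divide_distrib[symmetric])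
      also have "\<dots> \<le> ((\<Sum>k\<le>N n. \<bar>x n k\<bar>) + (\<Sum>k\<le>N n. \<bar>x n k\<bar>)) / c"
      proof (intro divide_right_mono add_mono)
        show "(\<Sum>k<N n. \<bar>x n k\<bar>) \<le> (\<Sum>k\<le>N n. \<bar>x n k\<bar>)" by (intro sum_mono2) auto
        have "(\<Sum>k\<le>N n. \<bar>x n k\<bar>) = \<bar>x n 0\<bar> + (\<Sum>k<N n. \<bar>x n (Suc k)\<bar>)"
          by (simp add: sum.atMost_shift)
        then show "(\<Sum>k<N n. \<bar>x n (Suc k)\<bar>) \<le> (\<Sum>k\<le>N n. \<bar>x n k\<bar>)" by simp
      qed (use c in simp)
      finally show ?thesis by simp
    qed
    have diff0: "(\<lambda>n. \<Sum>k<N n. \<bar>e n k - \<phi> n k\<bar>) \<longlonglongrightarrow> 0"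
    proof (rule tendsto_sandwich[OF _ _ tendsto_const])
      show "(\<lambda>n. 2 / c * (\<Sum>k\<le>N n. \<bar>x n k\<bar>)) \<longlonglongrightarrow> 0"
        using tendsto_mult_left[OF limits(4), of "2 / c"] by (simp add: x_def)
    qed (use sum_e_diff in \<open>auto intro!: always_eventually sum_nonneg\<close>)
    have diff1: "(\<lambda>n. \<Sum>k<N n. e n k - \<phi> n k) \<longlonglongrightarrow> 0"
      by (rule tendsto_rabs_zero_cancel, rule tendsto_sandwich[OF _ _ tendsto_const diff0])
         (auto intro!: always_eventually sum_abs)
    have "(\<lambda>n. (\<Sum>k<N n. \<bar>e n k - \<phi> n k\<bar>)\<^sup>2) \<longlonglongrightarrow> 0"
      using tendsto_power[OF diff0, of 2] by simp
    then have diff2: "(\<lambda>n. \<Sum>k<N n. (e n k - \<phi> n k)\<^sup>2) \<longlonglongrightarrow> 0"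
      by (rule tendsto_sandwich[OF _ _ tendsto_const, rotated 2])
         (auto intro!: always_eventually sum_nonneg sum_squares_le_square_sum_abs)
    have "ln (p T) - ln (p 0) = (g - \<sigma>\<^sup>2 / 2) * T + \<sigma> * (B T \<omega> - B 0 \<omega>)"
    proof (rule log_path_limit[where N = N and b = "\<lambda>s. B s \<omega>" and e = e, folded grid_def])
      show "filterlim N at_top sequentially"
        unfolding N_def using filterlim_compose[OF filterlim_Suc filterlim_subseq[OF r]] .
      show "(\<lambda>n. \<Sum>k<N n. e n k) \<longlonglongrightarrow> 0"
        using tendsto_add[OF diff1 limits(1)] by (simp add: sum.distrib[symmetric])
      show "(\<lambda>n. \<Sum>k<N n. (e n k)\<^sup>2) \<longlonglongrightarrow> 0"
        using tendsto_sum_add_square_zero[OF diff2 limits(2)] by simp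
      show "(\<lambda>n. \<Sum>k<N n. (B (grid T (N n) (Suc k)) \<omega> - B (grid T (N n) k) \<omega>)\<^sup>2) \<longlonglongrightarrow> T"
        by (rule limits(3))
      fix n k
      let ?s = "grid T (N n) k" and ?u = "grid T (N n) (Suc k)"
      have su: "0 \<le> ?s" "?s \<le> ?u" using T by (auto intro!: grid_T_nonneg grid_mono)
      have "continuous_on {0..?u} (\<lambda>v. g * p v)"
        by (intro continuous_intros continuous_on_subset[OF cont0]) auto
      then have "(\<lambda>v. g * p v) integrable_on {0..?u}" by (rule integrable_continuous_interval)
      then have "integral {0..?s} (\<lambda>v. g * p v) + integral {?s..?u} (\<lambda>v. g * p v)
          = integral {0..?u} (\<lambda>v. g * p v)"
        using su by (intro Henstock_Kurzweil_Integration.integral_combine) auto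
      moreover have "p v = p 0 + integral {0..v} (\<lambda>v. g * p v) + I v \<omega>" if "v \<in> {?s, ?u}" for v
        using elim(2) that unfolding p_def by blast
      ultimately have "p ?u - p ?s = integral {?s..?u} (\<lambda>v. g * p v) + (I ?u \<omega> - I ?s \<omega>)"
        by fastforce
      moreover have "p ?s * (\<sigma> * (B ?u \<omega> - B ?s \<omega>) + e n k) = I ?u \<omega> - I ?s \<omega>"
        using pos[OF su(1)] by (simp add: e_def)
      ultimately show "p ?u - p ?s = integral {?s..?u} (\<lambda>v. g * p v)
          + p ?s * (\<sigma> * (B ?u \<omega> - B ?s \<omega>) + e n k)" by simp
    qed (use cont pos T in \<open>auto simp: N_def\<close>)
    then show ?case by (simp add: p_def)
  qed
qed

end

lemma (in brownian_motion) price_closed_form: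
  assumes price: "lst_price_process M F B g \<sigma> P0 P" and T: "T > 0"
  shows "AE \<omega> in M. P T \<omega> = P0 * exp ((g - \<sigma>\<^sup>2 / 2) * T + \<sigma> * (B T \<omega> - B 0 \<omega>))"
proof -
  have adapted: "adapted_process F P" and cont: "continuous_process M P"
    and init: "AE \<omega> in M. P 0 \<omega> = P0" and pos: "AE \<omega> in M. \<forall>s\<ge>0. P s \<omega> > 0"
    using price unfolding lst_price_process_def by blast+
  define sol where "sol s I \<longleftrightarrow> has_ito_integral M F B (\<lambda>s \<omega>. \<sigma> * P s \<omega>) s I \<and>
      (AE \<omega> in M. P s \<omega> = P 0 \<omega> + integral {0..s} (\<lambda>s. g * P s \<omega>) + I \<omega>)" for s I
  have "\<forall>s\<ge>0. \<exists>I. sol s I"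
    using price unfolding lst_price_process_def sol_def by blast
  then obtain I where I: "\<And>s. s \<ge> 0 \<Longrightarrow> sol s (I s)"
    by metis
  have ito: "has_ito_integral M F B (\<lambda>s \<omega>. \<sigma> * P s \<omega>) s (I s)"
    and eq: "AE \<omega> in M. P s \<omega> = P 0 \<omega> + integral {0..s} (\<lambda>s. g * P s \<omega>) + I s \<omega>"
    if "s \<ge> 0" for s
    using I[OF that] by (simp_all only: sol_def)
  \<comment> \<open>The refinement factor for stage n, with the accuracy required by
    \<open>discretised_price\<close>.\<close>
  define good where "good n L \<longleftrightarrow> L > 0 \<and> (\<forall>k\<le>Suc n. expectation (\<lambda>\<omega>. min 1
      \<bar>(\<Sum>j<k * L. \<sigma> * P (grid T (Suc n * L) j) \<omega> * grid_increment T (Suc n * L) j \<omega>)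
        - I (grid T (Suc n) k) \<omega>\<bar>) \<le> 1 / (real n + 2)\<^sup>2)" for n L
  have "\<exists>L. good n L" for n
    unfolding good_def
  proof (rule ito_grid_approximation)
    show "has_ito_integral M F B (\<lambda>s \<omega>. \<sigma> * P s \<omega>) (grid T (Suc n) k) (I (grid T (Suc n) k))" for k
      using T by (intro ito grid_nonneg) simp
  qed (use T in auto)
  then obtain L where "\<And>n. good n (L n)"
    by metis
  then have L: "L n > 0" "k \<le> Suc n \<Longrightarrow> expectation (\<lambda>\<omega>. min 1
      \<bar>(\<Sum>j<k * L n. \<sigma> * P (grid T (Suc n * L n) j) \<omega> * grid_increment T (Suc n * L n) j \<omega>)
        - I (grid T (Suc n) k) \<omega>\<bar>) \<le> 1 / (real n + 2)\<^sup>2" for n k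
    unfolding good_def by blast+
  interpret discretised_price M F B P \<sigma> T L I
  proof unfold_locales
    show "I s \<in> borel_measurable M" if "s \<ge> 0" for s
      using ito[OF that] by (simp only: has_ito_integral_def)
  qed (fact adapted cont pos T L)+
  have "AE \<omega> in M. ln (P T \<omega>) - ln (P 0 \<omega>) = (g - \<sigma>\<^sup>2 / 2) * T + \<sigma> * (B T \<omega> - B 0 \<omega>)"
    by (rule log_price) (rule eq)
  then show ?thesis
    using init pos
  proof eventually_elim
    case (elim \<omega>)
    have "P T \<omega> > 0" "P 0 \<omega> > 0" using elim(3) T by auto
    \<comment> \<open>Here \<open>P0\<close> is positive because it equals the initial price of this
      path.\<close>
    then have "P T \<omega> = exp (ln (P0) + ((g - \<sigma>\<^sup>2 / 2) * T + \<sigma> * (B T \<omega> - B 0 \<omega>)))"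
      using elim(1,2) by (metis add.commute diff_add_cancel exp_ln)
    then show ?case using \<open>P 0 \<omega> > 0\<close> elim(2) by (simp add: exp_add)
  qed
qed

section \<open>Lognormal moments of the discounted price\<close>

lemma (in brownian_motion) discounted_price_expectations:
  assumes price: "lst_price_process M F B g \<sigma> P0 P" and t: "t > 0" and P0: "P0 > 0"
  shows "expectation (\<lambda>\<omega>. exit_discount m t * P t \<omega>) = P0 * exp ((g - m) * t)"
    and "expectation (\<lambda>\<omega>. (sqrt (exit_discount m t * P t \<omega>) - sqrt P0)\<^sup>2)
      = P0 * (exp ((g - m) * t) - 2 * exp ((g / 2 - m / 2 - \<sigma>\<^sup>2 / 8) * t) + 1)"
proof -
  define X where "X \<omega> = B t \<omega> - B 0 \<omega>" for \<omega>
  \<comment> \<open>Almost surely \<open>K c\<close> is the c-th power of the discounted price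
    divided by \<open>P0\<close>. Thus c = 1 gives the mean and c = 1/2 the square root, where
    -\<sigma>^2/4 + \<sigma>^2/8 leaves -\<sigma>^2/8.\<close>
  define K where "K c \<omega> = exp (c * ((g - m - \<sigma>\<^sup>2 / 2) * t)) * exp (c * \<sigma> * X \<omega>)" for c \<omega>
  have D: "distributed M lborel X (normal_density 0 (sqrt t))"
    using increment_distributed[of 0 t] t by (simp add: X_def[abs_def])
  note normal = expectation_exp_normal[OF D]
  have K_int: "integrable M (K c)" for c
    unfolding K_def using normal(1) t by simp
  have K_exp: "expectation (K c) = exp (c * ((g - m - \<sigma>\<^sup>2 / 2) * t) + c\<^sup>2 * \<sigma>\<^sup>2 * t / 2)" for c
    unfolding K_def using normal(2)[of "c * \<sigma>"] t
    by (simp add: exp_add power_mult_distrib)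
  have [measurable]: "P t \<in> borel_measurable M"
    using price t measurable_F_M unfolding lst_price_process_def adapted_process_def
    by (meson less_imp_le)
  have [measurable]: "K c \<in> borel_measurable M" for c
    using K_int by (rule borel_measurable_integrable)
  have DP: "AE \<omega> in M. exit_discount m t * P t \<omega> = P0 * K 1 \<omega>"
    using price_closed_form[OF price t]
  proof eventually_elim
    case (elim \<omega>)
    then show ?case
      by (simp add: K_def X_def exit_discount_def mult_exp_exp algebra_simps)
  qed
  then have "expectation (\<lambda>\<omega>. exit_discount m t * P t \<omega>) = expectation (\<lambda>\<omega>. P0 * K 1 \<omega>)"
    by (intro integral_cong_AE) auto
  also have "\<dots> = P0 * exp ((g - m) * t)" by (simp add: K_exp algebra_simps)
  finally show "expectation (\<lambda>\<omega>. exit_discount m t * P t \<omega>) = P0 * exp ((g - m) * t)" .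
  have "AE \<omega> in M. (sqrt (exit_discount m t * P t \<omega>) - sqrt P0)\<^sup>2
      = P0 * (K 1 \<omega> - 2 * K (1 / 2) \<omega> + 1)"
    using DP
  proof eventually_elim
    case (elim \<omega>)
    have K1: "K 1 \<omega> = (K (1 / 2) \<omega>)\<^sup>2" and "K (1 / 2) \<omega> > 0"
      by (simp_all add: K_def power_mult_distrib exp_double[symmetric])
    then have "sqrt (exit_discount m t * P t \<omega>) = sqrt P0 * K (1 / 2) \<omega>"
      using elim by (simp add: real_sqrt_mult)
    then have "(sqrt (exit_discount m t * P t \<omega>) - sqrt P0)\<^sup>2 = (sqrt P0)\<^sup>2 * (K (1 / 2) \<omega> - 1)\<^sup>2"
      by (simp add: power_mult_distrib[symmetric] algebra_simps)
    also have "\<dots> = P0 * (K 1 \<omega> - 2 * K (1 / 2) \<omega> + 1)"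
      using P0 K1 by (simp add: power2_diff)
    finally show ?case .
  qed
  then have "expectation (\<lambda>\<omega>. (sqrt (exit_discount m t * P t \<omega>) - sqrt P0)\<^sup>2)
      = expectation (\<lambda>\<omega>. P0 * (K 1 \<omega> - 2 * K (1 / 2) \<omega> + 1))"
    by (intro integral_cong_AE) auto
  also have "\<dots> = P0 * (expectation (K 1) - 2 * expectation (K (1 / 2)) + 1)"
    using K_int by (simp add: prob_space)
  also have "\<dots> = P0 * (exp ((g - m) * t) - 2 * exp ((g / 2 - m / 2 - \<sigma>\<^sup>2 / 8) * t) + 1)"
    by (simp add: K_exp power2_eq_square algebra_simps add_divide_distrib diff_divide_distrib)
  finally show "expectation (\<lambda>\<omega>. (sqrt (exit_discount m t * P t \<omega>) - sqrt P0)\<^sup>2)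
      = P0 * (exp ((g - m) * t) - 2 * exp ((g / 2 - m / 2 - \<sigma>\<^sup>2 / 8) * t) + 1)" .
qed

subsection \<open>The allocation problem\<close>

text \<open>For fixed x the objective decreases in a, and the least value a = P0 x is admissible
  because P0 x <= 1/2. The remaining condition in x is kept as a maximality statement so that zero
  slope is covered too.\<close>

lemma linear_programme_optimum:
  assumes P0: "P0 > 0" and C2: "C2 > 0"
    and obj: "\<And>x a. u (x, a) = C1 * x - C2 * a + (C3 :: real)"
  shows "is_arg_max u (feasible_allocation P0) (x, a) \<longleftrightarrow>
    0 \<le> x \<and> x \<le> 1 / (2 * P0) \<and> a = P0 * x \<and>
    (\<forall>x'. 0 \<le> x' \<and> x' \<le> 1 / (2 * P0) \<longrightarrow> (C1 - C2 * P0) * x' \<le> (C1 - C2 * P0) * x)"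
proof -
  have feasible: "feasible_allocation P0 (x, P0 * x)" if "0 \<le> x" "x \<le> 1 / (2 * P0)" for x
    using that P0 by (simp add: feasible_allocation_def field_simps)
  \<comment> \<open>Splits off the penalty for exceeding the lower bound on a.\<close>
  have u: "u (x, a) = (C1 - C2 * P0) * x - C2 * (a - P0 * x) + C3" for x a
    by (simp add: obj algebra_simps)
  have max: "is_arg_max u (feasible_allocation P0) (x, a) \<longleftrightarrow> feasible_allocation P0 (x, a) \<and>
      (\<forall>x' a'. feasible_allocation P0 (x', a') \<longrightarrow> u (x', a') \<le> u (x, a))"
    by (auto simp: is_arg_max_def not_less)
  show ?thesis
  proof
    assume opt: "is_arg_max u (feasible_allocation P0) (x, a)"
    then have "feasible_allocation P0 (x, a)" by (simp only: max)
    then have x: "0 \<le> x" "x \<le> 1 / (2 * P0)" "P0 * x \<le> a"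
      by (simp_all add: feasible_allocation_def)
    have "u (x, P0 * x) \<le> u (x, a)" using opt feasible[OF x(1,2)] by (simp only: max)
    then have "C2 * (a - P0 * x) \<le> 0" by (simp add: u)
    then have a: "a = P0 * x" using C2 x(3) by (simp add: mult_le_0_iff)
    have "(C1 - C2 * P0) * x' \<le> (C1 - C2 * P0) * x" if "0 \<le> x'" "x' \<le> 1 / (2 * P0)" for x'
    proof -
      have "u (x', P0 * x') \<le> u (x, a)" using opt feasible[OF that] by (simp only: max)
      then show ?thesis by (simp add: u a)
    qed
    with x a show "0 \<le> x \<and> x \<le> 1 / (2 * P0) \<and> a = P0 * x \<and>
      (\<forall>x'. 0 \<le> x' \<and> x' \<le> 1 / (2 * P0) \<longrightarrow> (C1 - C2 * P0) * x' \<le> (C1 - C2 * P0) * x)" by blast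
  next
    assume R: "0 \<le> x \<and> x \<le> 1 / (2 * P0) \<and> a = P0 * x \<and>
      (\<forall>x'. 0 \<le> x' \<and> x' \<le> 1 / (2 * P0) \<longrightarrow> (C1 - C2 * P0) * x' \<le> (C1 - C2 * P0) * x)"
    show "is_arg_max u (feasible_allocation P0) (x, a)"
      unfolding max
    proof (intro conjI allI impI)
      show "feasible_allocation P0 (x, a)" using R feasible by auto
      fix x' a' assume "feasible_allocation P0 (x', a')"
      then have "0 \<le> x'" "x' \<le> 1 / (2 * P0)" "P0 * x' \<le> a'"
        by (auto simp: feasible_allocation_def)
      then have "(C1 - C2 * P0) * x' \<le> (C1 - C2 * P0) * x" "0 \<le> C2 * (a' - P0 * x')"
        using R C2 by auto
      then show "u (x', a') \<le> u (x, a)" using R by (simp add: u)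
    qed
  qed
qed

theorem theorem3p12:
  fixes M :: "'a measure" and F :: "real \<Rightarrow> 'a measure"
    and B P :: "real \<Rightarrow> 'a \<Rightarrow> real"
    and P0 g \<sigma> m r \<rho> t x a :: real and \<phi> :: "real \<Rightarrow> real"
  assumes "standard_brownian_motion M F B"
    and "lst_price_process M F B g \<sigma> P0 P"
    and "g \<ge> 0" and "\<sigma> > 0" and "m > 0" and "r \<ge> 0" and "\<rho> \<ge> 0"
    and "rebasing P0 g r \<or> reward_bearing P0 g r"
    and "r + g - \<rho> - m > ln P0" and "ln P0 \<ge> 0"
    and "t > 0"
    and "\<forall>T\<ge>0. \<phi> absolutely_integrable_on {0..T}"
    and "chosen_allocation M P P0 r m \<rho> \<phi> t (x, a)"
  shows "x = 1 / (2 * P0) \<and> a = 1 / 2 \<longleftrightarrow>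
    discounted_fees \<rho> \<phi> t > fee_threshold P0 g \<sigma> r m \<rho> t"
proof -
  interpret brownian_motion M F B using assms(1) by unfold_locales
  have P0: "P0 > 0" using assms(8) by (auto simp: rebasing_def reward_bearing_def)
  have t: "t > 0" by fact
  note E = discounted_price_expectations[OF assms(2) t P0, of m]
  define I where "I = discounted_fees \<rho> \<phi> t"
  define C1 where "C1 = - exp (- \<rho> * t) *
    (P0 * (exp ((g - m) * t) - 2 * exp ((g / 2 - m / 2 - \<sigma>\<^sup>2 / 8) * t) + 1)) + I"
  define C2 where "C2 = exp (- \<rho> * t) * (P0 * exp ((g - m) * t) * exp (r * t) / P0 - 1)"
  define C3 where "C3 = exp (- \<rho> * t) * (P0 * exp ((g - m) * t) * exp (r * t) / P0)"
  let ?u = "investor_objective M P P0 r m \<rho> \<phi> t"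
  have obj: "?u (x, a) = C1 * x - C2 * a + C3" for x a
    by (simp only: investor_objective_def split_conv E C1_def C2_def C3_def I_def)
  \<comment> \<open>The standing assumption gives r + g - m > \<rho> + ln P0 >= 0, so the
    coefficient of a is strictly negative.\<close>
  have "(g - m) * t + r * t > 0"
  proof -
    have "(r + g - m) * t > 0" using assms by (intro mult_pos_pos) auto
    then show ?thesis by (simp add: algebra_simps)
  qed
  then have C2: "C2 > 0" using P0 by (simp add: C2_def exp_add[symmetric])
  have threshold: "C1 - C2 * P0 = I - fee_threshold P0 g \<sigma> r m \<rho> t"
  proof -
    have "exp ((g - m - \<rho>) * t) = exp (- \<rho> * t) * exp ((g - m) * t)"
      "exp ((1 / 2 * g - 1 / 8 * \<sigma>\<^sup>2 - 1 / 2 * m - \<rho>) * t)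
        = exp (- \<rho> * t) * exp ((g / 2 - m / 2 - \<sigma>\<^sup>2 / 8) * t)"
      by (simp_all add: exp_add[symmetric] algebra_simps)
    then show ?thesis
      using P0 by (simp add: C1_def C2_def fee_threshold_def algebra_simps)
  qed
  \<comment> \<open>The slope in x once a = P0 x is substituted; by \<open>threshold\<close> its
    sign decides the claim.\<close>
  define k where "k = C1 - C2 * P0"
  have opt: "optimal_allocation M P P0 r m \<rho> \<phi> t (x, a) \<longleftrightarrow>
    0 \<le> x \<and> x \<le> 1 / (2 * P0) \<and> a = P0 * x \<and>
    (\<forall>x'. 0 \<le> x' \<and> x' \<le> 1 / (2 * P0) \<longrightarrow> k * x' \<le> k * x)" for x a
    unfolding optimal_allocation_def k_def by (rule linear_programme_optimum[OF P0 C2 obj])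
  have chosen: "optimal_allocation M P P0 r m \<rho> \<phi> t (x, a)"
    "(\<forall>x'\<in>{0..1 / (2 * P0)}. \<exists>a'. optimal_allocation M P P0 r m \<rho> \<phi> t (x', a')) \<Longrightarrow> x = 0"
    using assms(13) unfolding chosen_allocation_def by auto
  have "x = 1 / (2 * P0) \<and> a = 1 / 2 \<longleftrightarrow> k > 0"
  proof
    assume "k > 0"
    have x: "x \<le> 1 / (2 * P0)" "a = P0 * x"
      and x_max: "\<forall>x'. 0 \<le> x' \<and> x' \<le> 1 / (2 * P0) \<longrightarrow> k * x' \<le> k * x"
      using chosen(1) by (auto simp only: opt)
    have "k * (1 / (2 * P0)) \<le> k * x" using x_max P0 by (simp del: times_divide_eq_right)
    then have "x = 1 / (2 * P0)" using \<open>k > 0\<close> x(1)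
      by (simp only: mult_le_cancel_left_pos order_antisym)
    then show "x = 1 / (2 * P0) \<and> a = 1 / 2" using x(2) P0 by simp
  next
    assume x: "x = 1 / (2 * P0) \<and> a = 1 / 2"
    then have "x > 0" using P0 by simp
    \<comment> \<open>Comparison with the feasible competitor x' = 0.\<close>
    have "0 \<le> k * x" using chosen(1) P0 by (auto simp: opt dest: spec[of _ 0])
    then have "k \<ge> 0" using \<open>x > 0\<close> by (simp add: zero_le_mult_iff)
    moreover have "k \<noteq> 0"
    proof
      assume "k = 0"
      then have "x = 0" by (intro chosen(2)) (auto simp: opt)
      then show False using \<open>x > 0\<close> by simp
    qed
    ultimately show "k > 0" by simp
  qed
  then show ?thesis by (simp add: k_def threshold I_def)
qed

end
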